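(* Let $\mathfrak{gl}_n=\mathfrak{gl}_n(\mathbb{C})$ and let $I=\sum_{i=1}^n E_{i,i}$ be the identity matrix. The following equalities hold, up to a change of variables: \begin{align*} IE_{1,n}E_{2,n-1}-IE_{1,n-1}E_{2,n} &= T_{cw,4},\\ E_{1,n}E_{1,n-1}E_{2,n}-E_{1,n}E_{1,n}E_{2,n-1} &= T_{CW,2},\\ \sum_{i=1}^n IE_{1,i}E_{i,n} &= T_{cw,2n-2},\\ \sum_{i=1}^n E_{1,n}E_{1,i}E_{i,n} &= T_{CW,2n-4},\\ \sum_{i,j=1}^n E_{1,n}E_{i,j}E_{j,i} &= T_{CW,n^2-2}, \end{align*} i.e. five of the highest weight vectors of the $\mathfrak{sl}_n$-representation $S^3(\mathfrak{gl}_n)$ (the ones on the left-hand sides) are Coppersmith--Winograd tensors.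
   Context: $E_{i,j}$ is the $n\times n$ matrix with a $1$ at position $(i,j)$ and $0$ elsewhere; these form a basis of $\mathfrak{gl}_n$, on which $\mathfrak{sl}_n$ acts by the adjoint action. A product $xyz$ of elements of a vector space $V$ denotes the symmetric tensor $\frac16(x\otimes y\otimes z+x\otimes z\otimes y+y\otimes x\otimes z+y\otimes z\otimes x+z\otimes x\otimes y+z\otimes y\otimes x)$, an element of $S^3(V)$, i.e. a cubic form in the elements of $V$. The small and big Coppersmith--Winograd tensors are the symmetric tensors (cubic forms in $\mathbb{C}[x_0,\dots,x_{m+1}]_3$) $$T_{cw,m}=\sum_{i=1}^m 3x_0x_i^2,\qquad T_{CW,m}=3x_0^2x_{m+1}+3\sum_{i=1}^m x_0x_i^2 .$$ Equality up to a change of variables of $F\in S^3(\mathfrak{gl}_n)$ with one of these forms means that there is an injective $\mathbb{C}$-linear map from the span of the variables occurring in the form ($x_0,\dots,x_m$ for $T_{cw,m}$, and $x_0,\dots,x_{m+1}$ for $T_{CW,m}$) to $\mathfrak{gl}_n$ whose induced map on cubic forms sends the form to $F$.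
   Formalization: The formal statement takes n ≥ 2, and asserts the first and third equalities (with T_{cw,4} and T_{cw,2n-2}) only for n ≥ 3, since both fail at n = 2, where the left-hand sides have too few essential variables. *)

theory Defs
  imports
    "HOL-Library.Function_Algebras"
    "Jordan_Normal_Form.Matrix"
begin

text \<open>
  An element of \<open>V \<otimes> V \<otimes> V\<close>, where \<open>V\<close> is a complex vector space with a distinguished basis
  indexed by a finite set of elements of type \<open>'i\<close>, is its array of coordinates; it vanishes
  outside the index set. The basis of \<open>\<complex>\<^sup>N\<close> is \<open>unit_vec N k\<close>, indexed by \<open>k < N\<close>; the basis of
  \<open>gl\<^sub>n\<close> consists of the matrix units, indexed by their (0-based) positions \<open>(i, j)\<close> with
  \<open>i < n\<close>, \<open>j < n\<close>. Addition of tensors is pointwise.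
\<close>

type_synonym 'i tensor3 = "'i \<Rightarrow> 'i \<Rightarrow> 'i \<Rightarrow> complex"

definition scale3 :: "complex \<Rightarrow> 'i tensor3 \<Rightarrow> 'i tensor3" where
  "scale3 s T = (\<lambda>a b c. s * T a b c)"

definition pure3 :: "('i \<Rightarrow> complex) \<Rightarrow> ('i \<Rightarrow> complex) \<Rightarrow> ('i \<Rightarrow> complex) \<Rightarrow> 'i tensor3" where
  "pure3 x y z = (\<lambda>a b c. x a * y b * z c)"

definition sym3 :: "('i \<Rightarrow> complex) \<Rightarrow> ('i \<Rightarrow> complex) \<Rightarrow> ('i \<Rightarrow> complex) \<Rightarrow> 'i tensor3" where
  "sym3 x y z = scale3 (1/6)
     (pure3 x y z + pure3 x z y + pure3 y x z + pure3 y z x + pure3 z x y + pure3 z y x)"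

definition vec_coord :: "complex vec \<Rightarrow> nat \<Rightarrow> complex" where
  "vec_coord v k = (if k < dim_vec v then v $ k else 0)"

definition mat_coord :: "complex mat \<Rightarrow> nat \<times> nat \<Rightarrow> complex" where
  "mat_coord A p = (if fst p < dim_row A \<and> snd p < dim_col A then A $$ p else 0)"

definition vec_prod3 :: "complex vec \<Rightarrow> complex vec \<Rightarrow> complex vec \<Rightarrow> nat tensor3" where
  "vec_prod3 x y z = sym3 (vec_coord x) (vec_coord y) (vec_coord z)"

definition mat_prod3 :: "complex mat \<Rightarrow> complex mat \<Rightarrow> complex mat \<Rightarrow> (nat \<times> nat) tensor3" where
  "mat_prod3 A B C = sym3 (mat_coord A) (mat_coord B) (mat_coord C)"

text \<open>\<open>mat_unit n i j\<close> is \<open>E\<^bsub>i,j\<^esub>\<close>, with \<open>i\<close> and \<open>j\<close> counted from 1.\<close>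

definition mat_unit :: "nat \<Rightarrow> nat \<Rightarrow> nat \<Rightarrow> complex mat" where
  "mat_unit n i j = mat n n (\<lambda>(k, l). if Suc k = i \<and> Suc l = j then 1 else 0)"

text \<open>
  The small form lives on the span of \<open>x\<^sub>0, \<dots>, x\<^sub>m\<close>, the big one on the span of
  \<open>x\<^sub>0, \<dots>, x\<^bsub>m+1\<^esub>\<close>.
\<close>

definition small_CW :: "nat \<Rightarrow> nat tensor3" where
  "small_CW m = (let x = unit_vec (m + 1) in
     \<Sum>i=1..m. scale3 3 (vec_prod3 (x 0) (x i) (x i)))"

definition big_CW :: "nat \<Rightarrow> nat tensor3" where
  "big_CW m = (let x = unit_vec (m + 2) in
     scale3 3 (vec_prod3 (x 0) (x 0) (x (m + 1))) +
     scale3 3 (\<Sum>i=1..m. vec_prod3 (x 0) (x i) (x i)))"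

definition linear_to_gl :: "nat \<Rightarrow> nat \<Rightarrow> (complex vec \<Rightarrow> complex mat) \<Rightarrow> bool" where
  "linear_to_gl N n f \<longleftrightarrow>
     (\<forall>u\<in>carrier_vec N. f u \<in> carrier_mat n n) \<and>
     (\<forall>u\<in>carrier_vec N. \<forall>v\<in>carrier_vec N. f (u + v) = f u + f v) \<and>
     (\<forall>s. \<forall>u\<in>carrier_vec N. f (s \<cdot>\<^sub>v u) = s \<cdot>\<^sub>m f u)"

text \<open>The map \<open>f \<otimes> f \<otimes> f\<close>, for \<open>f\<close> linear on \<open>\<complex>\<^sup>N\<close>.\<close>

definition induced3 :: "nat \<Rightarrow> (complex vec \<Rightarrow> complex mat) \<Rightarrow> nat tensor3 \<Rightarrow> (nat \<times> nat) tensor3"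
  where
  "induced3 N f T = (\<Sum>p<N. \<Sum>q<N. \<Sum>r<N. scale3 (T p q r)
     (pure3 (mat_coord (f (unit_vec N p))) (mat_coord (f (unit_vec N q)))
        (mat_coord (f (unit_vec N r)))))"

definition eq_change_vars :: "nat \<Rightarrow> (nat \<times> nat) tensor3 \<Rightarrow> nat \<Rightarrow> nat tensor3 \<Rightarrow> bool" where
  "eq_change_vars n F N T \<longleftrightarrow>
     (\<exists>f. linear_to_gl N n f \<and> inj_on f (carrier_vec N) \<and> induced3 N f T = F)"

definition eq_small_CW :: "nat \<Rightarrow> (nat \<times> nat) tensor3 \<Rightarrow> nat \<Rightarrow> bool" where
  "eq_small_CW n F m \<longleftrightarrow> eq_change_vars n F (m + 1) (small_CW m)"

definition eq_big_CW :: "nat \<Rightarrow> (nat \<times> nat) tensor3 \<Rightarrow> nat \<Rightarrow> bool" where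
  "eq_big_CW n F m \<longleftrightarrow> eq_change_vars n F (m + 2) (big_CW m)"

definition S3_gl :: "nat \<Rightarrow> (nat \<times> nat) tensor3 set" where
  "S3_gl n = {T. (\<forall>a b c. T a b c = T b a c \<and> T a b c = T a c b) \<and>
     (\<forall>a b c. T a b c \<noteq> 0 \<longrightarrow> {a, b, c} \<subseteq> {..<n} \<times> {..<n})}"

definition sl :: "nat \<Rightarrow> complex mat set" where
  "sl n = {A \<in> carrier_mat n n. (\<Sum>i<n. A $$ (i, i)) = 0}"

text \<open>
  \<open>ad_coeff n A a p\<close> is the coefficient at the basis vector with index \<open>a\<close> of the bracket of \<open>A\<close>
  with the basis vector with index \<open>p\<close>. The action on tensors extends \<open>ad A\<close> by the Leibniz rule.
\<close>

definition ad_coeff :: "nat \<Rightarrow> complex mat \<Rightarrow> nat \<times> nat \<Rightarrow> nat \<times> nat \<Rightarrow> complex" where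
  "ad_coeff n A a p =
     (let X = mat_unit n (Suc (fst p)) (Suc (snd p)) in mat_coord (A * X - X * A) a)"

definition ad3 :: "nat \<Rightarrow> complex mat \<Rightarrow> (nat \<times> nat) tensor3 \<Rightarrow> (nat \<times> nat) tensor3" where
  "ad3 n A T = (\<lambda>a b c. \<Sum>p\<in>{..<n} \<times> {..<n}.
     ad_coeff n A a p * T p b c + ad_coeff n A b p * T a p c + ad_coeff n A c p * T a b p)"

text \<open>
  Highest weight vectors with respect to the diagonal Cartan subalgebra and the upper triangular
  Borel subalgebra of \<open>sl\<^sub>n\<close>. Linearity of the weight is automatic because the vector is nonzero.
\<close>

definition highest_weight_vector :: "nat \<Rightarrow> (nat \<times> nat) tensor3 \<Rightarrow> bool" where
  "highest_weight_vector n T \<longleftrightarrow> T \<in> S3_gl n \<and> T \<noteq> 0 \<and>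
     (\<exists>wt. \<forall>H\<in>sl n. diagonal_mat H \<longrightarrow> ad3 n H T = scale3 (wt H) T) \<and>
     (\<forall>A\<in>sl n. (\<forall>i<n. \<forall>j\<le>i. A $$ (i, j) = 0) \<longrightarrow> ad3 n A T = 0)"

end

theory Submission
  imports Defs
begin

text \<open>
  The Coppersmith--Winograd part: each left-hand side is \<open>x\<close> times a quadratic form, with \<open>x = I\<close> or
  \<open>x = E\<^bsub>1,n\<^esub>\<close>, and the quadratic form is a sum \<open>\<Sum> v\<^sub>s v\<^bsub>\<sigma> s\<^esub>\<close> over linearly independent \<open>v\<^sub>s\<close> for
  an involution \<open>\<sigma>\<close> of the index set, plus a multiple of \<open>x z\<close> in the big case. A complex change of
  variables turns it into a sum of squares.

  The highest weight part: \<open>x\<close> is itself a highest weight vector of \<open>gl\<^sub>n\<close>, and the quadratic forms are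
  a \<open>2 \<times> 2\<close> minor in the first two rows and the last two columns, the top right entry of the square
  of the generic matrix, and the trace of that square.
\<close>

section \<open>Change of variables\<close>

lemma sum_apply: "(\<Sum>i\<in>A. f i) x = (\<Sum>i\<in>A. f i x :: 'b :: comm_monoid_add)"
  by (induction A rule: infinite_finite_induct) auto

lemma sym3_apply:
  "sym3 x y z a b c = (x a * y b * z c + x a * z b * y c + y a * x b * z c + y a * z b * x c
     + z a * x b * y c + z a * y b * x c) / 6"
  by (simp add: sym3_def scale3_def pure3_def)

lemma induced3_add: "induced3 N f (S + T) = induced3 N f S + induced3 N f T"
  by (simp add: induced3_def scale3_def fun_eq_iff sum_apply ring_distribs sum.distrib)

lemma induced3_scale3: "induced3 N f (scale3 s T) = scale3 s (induced3 N f T)"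
  by (simp add: induced3_def scale3_def fun_eq_iff sum_apply sum_distrib_left mult.assoc)

lemma induced3_zero: "induced3 N f 0 = 0"
  by (simp add: induced3_def scale3_def fun_eq_iff sum_apply)

lemma induced3_sum: "induced3 N f (\<Sum>i\<in>A. T i) = (\<Sum>i\<in>A. induced3 N f (T i))"
  by (induction A rule: infinite_finite_induct)
    (simp_all only: sum.infinite sum.empty sum.insert induced3_add induced3_zero not_False_eq_True)

lemma induced3_pure3_unit_vec:
  assumes "i < N" "j < N" "k < N"
  shows "induced3 N f (pure3 (vec_coord (unit_vec N i)) (vec_coord (unit_vec N j))
      (vec_coord (unit_vec N k)))
    = pure3 (mat_coord (f (unit_vec N i))) (mat_coord (f (unit_vec N j)))
      (mat_coord (f (unit_vec N k)))" (is "?L = ?R")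
proof (intro ext)
  fix a b c
  have u: "vec_coord (unit_vec N i) p = (if p = i then 1 else 0)" if "i < N" for i p
    using that by (simp add: vec_coord_def)
  have delta: "(\<Sum>p<N. (if p = i then 1 else 0) * X p) = X i" if "i < N" for i and X :: "nat \<Rightarrow> complex"
    using that by (simp add: if_distrib[of "\<lambda>t. t * _"] cong: if_cong)
  show "?L a b c = ?R a b c"
    unfolding induced3_def sum_apply scale3_def pure3_def u[OF assms(1)] u[OF assms(2)] u[OF assms(3)]
    using assms by (simp only: mult.assoc sum_distrib_left[symmetric] delta)
qed

lemma induced3_vec_prod3:
  assumes "i < N" "j < N" "k < N"
  shows "induced3 N f (vec_prod3 (unit_vec N i) (unit_vec N j) (unit_vec N k))
    = sym3 (mat_coord (f (unit_vec N i))) (mat_coord (f (unit_vec N j)))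
      (mat_coord (f (unit_vec N k)))"
  using assms by (simp add: vec_prod3_def sym3_def induced3_scale3 induced3_add
      induced3_pure3_unit_vec)

text \<open>The induced map depends on \<open>f\<close> only through the images of the basis
  vectors. Giving their coordinate functions a name \<open>g\<close> lets these be chosen before any
  concrete \<open>f\<close> exists.\<close>

lemma induced3_small_CW:
  assumes "\<And>k. k \<le> m \<Longrightarrow> mat_coord (f (unit_vec (m + 1) k)) = g k"
  shows "induced3 (m + 1) f (small_CW m) = scale3 3 (\<Sum>i=1..m. sym3 (g 0) (g i) (g i))"
proof -
  have "induced3 (m + 1) f (small_CW m)
      = (\<Sum>i=1..m. scale3 3 (sym3 (g 0) (g i) (g i)))"
    unfolding small_CW_def Let_def induced3_sum
    using assms by (intro sum.cong refl) (auto simp: induced3_scale3 induced3_vec_prod3)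
  then show ?thesis
    by (simp add: scale3_def fun_eq_iff sum_apply sum_distrib_left)
qed

lemma induced3_big_CW:
  assumes "\<And>k. k \<le> m + 1 \<Longrightarrow> mat_coord (f (unit_vec (m + 2) k)) = g k"
  shows "induced3 (m + 2) f (big_CW m) = scale3 3 (sym3 (g 0) (g 0) (g (m + 1)))
    + scale3 3 (\<Sum>i=1..m. sym3 (g 0) (g i) (g i))"
proof -
  have "induced3 (m + 2) f (\<Sum>i=1..m. vec_prod3 (unit_vec (m + 2) 0) (unit_vec (m + 2) i)
      (unit_vec (m + 2) i)) = (\<Sum>i=1..m. sym3 (g 0) (g i) (g i))"
    unfolding induced3_sum
    by (intro sum.cong refl, subst induced3_vec_prod3) (use assms in auto)
  moreover have "induced3 (m + 2) f (vec_prod3 (unit_vec (m + 2) 0) (unit_vec (m + 2) 0)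
      (unit_vec (m + 2) (m + 1))) = sym3 (g 0) (g 0) (g (m + 1))"
    by (subst induced3_vec_prod3) (use assms in auto)
  ultimately show ?thesis
    unfolding big_CW_def Let_def induced3_add induced3_scale3 by simp
qed

section \<open>Linear independence as a criterion for a change of variables\<close>

definition supported :: "nat \<Rightarrow> (nat \<times> nat \<Rightarrow> complex) \<Rightarrow> bool" where
  "supported n x \<longleftrightarrow> (\<forall>p. p \<notin> {..<n} \<times> {..<n} \<longrightarrow> x p = 0)"

lemma supportedD: "supported n x \<Longrightarrow> p \<notin> {..<n} \<times> {..<n} \<Longrightarrow> x p = 0"
  unfolding supported_def by blast

lemma supported_intros:
  "supported n x \<Longrightarrow> supported n (\<lambda>p. s * x p)"
  "supported n x \<Longrightarrow> supported n (\<lambda>p. s * x p / r)"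
  "supported n x \<Longrightarrow> supported n y \<Longrightarrow> supported n (\<lambda>p. x p + y p)"
  "supported n x \<Longrightarrow> supported n y \<Longrightarrow> supported n (x + y)"
  "supported n x \<Longrightarrow> supported n (- x)"
  by (simp_all add: supported_def)

text \<open>A linear map is determined by the images of the basis vectors, and any coordinate
  functions supported on the index square are such images; injectivity is their linear independence.
  The last hypothesis speaks of every \<open>f\<close> with these images, so that applications never
  meet the map built here.\<close>

lemma eq_change_varsI:
  fixes g :: "nat \<Rightarrow> nat \<times> nat \<Rightarrow> complex"
  assumes supp: "\<And>k. k < N \<Longrightarrow> supported n (g k)"
    and indep: "\<And>c k. (\<And>p. (\<Sum>k<N. c k * g k p) = 0) \<Longrightarrow> k < N \<Longrightarrow> c k = 0"
    and T: "\<And>f. (\<And>k. k < N \<Longrightarrow> mat_coord (f (unit_vec N k)) = g k) \<Longrightarrow> induced3 N f T = F"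
  shows "eq_change_vars n F N T"
proof -
  define f where "f u = mat n n (\<lambda>p. \<Sum>k<N. u $ k * g k p)" for u :: "complex vec"
  have "linear_to_gl N n f"
    unfolding linear_to_gl_def f_def
    by (auto intro!: eq_matI simp: sum.distrib[symmetric] sum_distrib_left ring_distribs mult.assoc
        intro!: sum.cong)
  moreover have "inj_on f (carrier_vec N)"
  proof (rule inj_onI)
    fix u v :: "complex vec"
    assume u: "u \<in> carrier_vec N" and v: "v \<in> carrier_vec N" and e: "f u = f v"
    have "(\<Sum>k<N. (u $ k - v $ k) * g k p) = 0" for p
    proof (cases "p \<in> {..<n} \<times> {..<n}")
      case True
      then obtain i j where p: "p = (i, j)" "i < n" "j < n"
        by auto
      have "f u $$ p = f v $$ p"
        using e by simp
      then show ?thesis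
        using p by (simp add: f_def left_diff_distrib sum_subtractf)
    next
      \<comment> \<open>Equality of the two matrices says nothing outside the index square; there
        each \<open>g k\<close> vanishes by its support.\<close>
      case False
      then show ?thesis
        using supp by (intro sum.neutral) (simp add: supportedD[of n])
    qed
    then have "u $ k - v $ k = 0" if "k < N" for k
      using indep[of "\<lambda>k. u $ k - v $ k"] that by blast
    then show "u = v"
      using u v by (intro eq_vecI) auto
  qed
  moreover have "mat_coord (f (unit_vec N k)) = g k" if k: "k < N" for k
  proof
    fix p
    have "(\<Sum>l<N. unit_vec N k $ l * g l p) = (\<Sum>l<N. if l = k then g l p else 0)"
      using k by (intro sum.cong) auto
    then have "(\<Sum>l<N. unit_vec N k $ l * g l p) = g k p"
      using k by simp
    then show "mat_coord (f (unit_vec N k)) p = g k p"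
      using supportedD[OF supp[OF k], of p] by (cases p) (auto simp: mat_coord_def f_def)
  qed
  ultimately show ?thesis
    unfolding eq_change_vars_def using T by blast
qed

text \<open>
  If \<open>\<sigma>\<close> is an involution, then \<open>y\<^sub>s = \<alpha> v\<^sub>s + \<beta> v\<^bsub>\<sigma> s\<^esub>\<close> with \<open>\<alpha>\<^sup>2 + \<beta>\<^sup>2 = 0\<close> and \<open>2 \<alpha> \<beta> = 1\<close>
  satisfies \<open>\<Sum> y\<^sub>s\<^sup>2 = \<Sum> v\<^sub>s v\<^bsub>\<sigma> s\<^esub>\<close>, whether or not \<open>\<sigma>\<close> has fixed points.
\<close>

definition \<alpha> :: complex where "\<alpha> = (1 - \<i>) / 2"
definition \<beta> :: complex where "\<beta> = (1 + \<i>) / 2"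

text \<open>The squares of \<alpha> and \<beta> are -i/2 and i/2, and their product is 1/2. The
  third expression is the determinant of the symmetric 2 x 2 matrix with diagonal \<alpha> and
  off-diagonal \<beta>, which makes the twist invertible.\<close>

lemma twist_coeffs: "\<alpha> * \<alpha> + \<beta> * \<beta> = 0" "2 * (\<alpha> * \<beta>) = 1" "\<alpha> * \<alpha> - \<beta> * \<beta> \<noteq> 0"
  by (auto simp: \<alpha>_def \<beta>_def complex_eq_iff)

definition twist :: "('s \<Rightarrow> 's) \<Rightarrow> ('s \<Rightarrow> 'i \<Rightarrow> complex) \<Rightarrow> 's \<Rightarrow> 'i \<Rightarrow> complex" where
  "twist \<sigma> v s = (\<lambda>p. \<alpha> * v s p + \<beta> * v (\<sigma> s) p)"

lemma sum_involution:
  assumes "\<And>s. s \<in> S \<Longrightarrow> \<sigma> s \<in> S" "\<And>s. s \<in> S \<Longrightarrow> \<sigma> (\<sigma> s) = s"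
  shows "(\<Sum>s\<in>S. f (\<sigma> s)) = (\<Sum>s\<in>S. f s)"
  using assms by (intro sum.reindex_bij_witness[of S \<sigma> \<sigma>]) auto

lemma sum_sym3_twist:
  assumes "\<And>s. s \<in> S \<Longrightarrow> \<sigma> s \<in> S" "\<And>s. s \<in> S \<Longrightarrow> \<sigma> (\<sigma> s) = s"
  shows "(\<Sum>s\<in>S. sym3 x (twist \<sigma> v s) (twist \<sigma> v s)) = (\<Sum>s\<in>S. sym3 x (v s) (v (\<sigma> s)))"
    (is "?L = ?R")
proof (intro ext)
  fix a b c
  let ?q = "\<lambda>s. sym3 x (v s) (v s) a b c"
  have "sym3 x (twist \<sigma> v s) (twist \<sigma> v s) a b c = \<alpha> * \<alpha> * ?q s + \<beta> * \<beta> * ?q (\<sigma> s)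
      + 2 * (\<alpha> * \<beta>) * sym3 x (v s) (v (\<sigma> s)) a b c" for s
    unfolding sym3_apply twist_def by (simp add: field_simps)
  then have "?L a b c = \<alpha> * \<alpha> * (\<Sum>s\<in>S. ?q s) + \<beta> * \<beta> * (\<Sum>s\<in>S. ?q (\<sigma> s))
      + 2 * (\<alpha> * \<beta>) * ?R a b c"
    by (simp add: sum_apply sum.distrib sum_distrib_left)
  \<comment> \<open>The pure squares do not cancel term by term. They cancel in the sum, because
    \<sigma> permutes \<open>S\<close>.\<close>
  also have "(\<Sum>s\<in>S. ?q (\<sigma> s)) = (\<Sum>s\<in>S. ?q s)"
    by (rule sum_involution) (use assms in auto)
  also have "\<alpha> * \<alpha> * (\<Sum>s\<in>S. ?q s) + \<beta> * \<beta> * (\<Sum>s\<in>S. ?q s) + 2 * (\<alpha> * \<beta>) * ?R a b c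
      = (\<alpha> * \<alpha> + \<beta> * \<beta>) * (\<Sum>s\<in>S. ?q s) + 2 * (\<alpha> * \<beta>) * ?R a b c"
    by (simp add: ring_distribs)
  also have "\<dots> = ?R a b c"
    by (simp only: twist_coeffs) simp
  finally show "?L a b c = ?R a b c" .
qed

text \<open>Reindexing the \<beta> part by \<sigma> moves the twist from the vectors to the
  coefficients, so a linear relation among the twisted vectors becomes one among the
  \<open>v s\<close>.\<close>

lemma sum_twist:
  assumes "\<And>s. s \<in> S \<Longrightarrow> \<sigma> s \<in> S" "\<And>s. s \<in> S \<Longrightarrow> \<sigma> (\<sigma> s) = s"
  shows "(\<Sum>s\<in>S. c s * twist \<sigma> v s p) = (\<Sum>s\<in>S. (\<alpha> * c s + \<beta> * c (\<sigma> s)) * v s p)"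
proof -
  have "(\<Sum>s\<in>S. c s * \<beta> * v (\<sigma> s) p) = (\<Sum>s\<in>S. c (\<sigma> s) * \<beta> * v (\<sigma> (\<sigma> s)) p)"
    by (rule sum_involution[symmetric]) (use assms in auto)
  also have "\<dots> = (\<Sum>s\<in>S. \<beta> * c (\<sigma> s) * v s p)"
    using assms by (intro sum.cong) auto
  finally show ?thesis
    by (simp add: twist_def ring_distribs sum.distrib mult_ac)
qed

text \<open>The equations at \<open>s\<close> and at \<sigma> \<open>s\<close> form a linear system
  in \<open>c s\<close> and \<open>c (\<sigma> s)\<close> whose determinant is nonzero. The
  elimination of \<open>c (\<sigma> s)\<close> also covers the fixed points of \<sigma>, where the
  two equations coincide.\<close>

lemma twist_coeff_zero:
  assumes "\<And>s. s \<in> S \<Longrightarrow> \<sigma> s \<in> S" "\<And>s. s \<in> S \<Longrightarrow> \<sigma> (\<sigma> s) = s"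
    and z: "\<And>s. s \<in> S \<Longrightarrow> \<alpha> * c s + \<beta> * c (\<sigma> s) = 0" and s: "s \<in> S"
  shows "c s = 0"
proof -
  have "\<alpha> * c s + \<beta> * c (\<sigma> s) = 0" "\<alpha> * c (\<sigma> s) + \<beta> * c s = 0"
    using z[of s] z[of "\<sigma> s"] assms by auto
  moreover have "(\<alpha> * \<alpha> - \<beta> * \<beta>) * c s
      = \<alpha> * (\<alpha> * c s + \<beta> * c (\<sigma> s)) - \<beta> * (\<alpha> * c (\<sigma> s) + \<beta> * c s)"
    by (simp add: algebra_simps)
  ultimately have "(\<alpha> * \<alpha> - \<beta> * \<beta>) * c s = 0"
    by simp
  then show ?thesis
    using twist_coeffs(3) by simp
qed

section \<open>Coppersmith-Winograd forms from an involution\<close>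

lemma scale3_sym3: "scale3 r (sym3 x y z) = sym3 (\<lambda>p. r * x p) y z"
  by (simp add: scale3_def sym3_apply fun_eq_iff algebra_simps add_divide_distrib)

lemma scale3_sum: "scale3 r (\<Sum>i\<in>A. T i) = (\<Sum>i\<in>A. scale3 r (T i))"
  by (simp add: scale3_def fun_eq_iff sum_apply sum_distrib_left)

lemma scale3_scale3: "scale3 r (scale3 s T) = scale3 (r * s) T"
  by (simp add: scale3_def mult.assoc)

text \<open>The variable with index 0 goes to a multiple of \<open>x\<close>, and the others go to
  the twisted vectors, enumerated by a bijection \<open>h\<close> from \<open>{1..m}\<close> to
  \<open>S\<close>. Since the twist is invertible, independence of \<open>x\<close> and the
  \<open>v s\<close> passes to the images.\<close>

lemma eq_small_CW_involution:
  fixes v :: "'s \<Rightarrow> nat \<times> nat \<Rightarrow> complex"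
  assumes S: "finite S" "card S = m"
    and \<sigma>: "\<And>s. s \<in> S \<Longrightarrow> \<sigma> s \<in> S" "\<And>s. s \<in> S \<Longrightarrow> \<sigma> (\<sigma> s) = s"
    and supp: "supported n x" "\<And>s. s \<in> S \<Longrightarrow> supported n (v s)"
    and "r \<noteq> 0"
    and indep: "\<And>c0 c. (\<And>p. c0 * x p + (\<Sum>s\<in>S. c s * v s p) = 0) \<Longrightarrow> c0 = 0 \<and> (\<forall>s\<in>S. c s = 0)"
  shows "eq_small_CW n (scale3 r (\<Sum>s\<in>S. sym3 x (v s) (v (\<sigma> s)))) m"
proof -
  obtain h where h: "bij_betw h {1..m} S"
    using S by (metis finite_same_card_bij finite_atLeastAtMost card_atLeastAtMost diff_Suc_1)
  define h' where "h' = inv_into {1..m} h"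
  have h': "h' (h i) = i" if "i \<in> {1..m}" for i
    using that h by (simp add: h'_def bij_betw_inv_into_left)
  \<comment> \<open>The factor \<open>r / 3\<close> replaces the coefficient 3 of the
    Coppersmith-Winograd form by \<open>r\<close>.\<close>
  define g where "g k = (if k = 0 then \<lambda>p. r / 3 * x p else twist \<sigma> v (h k))" for k :: nat
  have hS: "h i \<in> S" if "i \<in> {1..m}" for i
    using h that by (auto simp: bij_betw_def)
  have split: "{..<m + 1} = insert 0 {1..m}"
    by auto
  show ?thesis
    unfolding eq_small_CW_def
  proof (rule eq_change_varsI[where g = g])
    show "supported n (g k)" if "k < m + 1" for k
      using that supp \<sigma> hS[of k] by (auto simp: g_def twist_def intro!: supported_intros)
  next
    fix c k
    assume z: "\<And>p. (\<Sum>k<m + 1. c k * g k p) = 0" and k: "k < m + 1"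
    \<comment> \<open>The coefficients are carried over from positions to elements of
      \<open>S\<close>, where \<sigma> acts.\<close>
    define c' where "c' s = c (h' s)" for s
    have "c 0 * (r / 3) * x p + (\<Sum>s\<in>S. (\<alpha> * c' s + \<beta> * c' (\<sigma> s)) * v s p) = 0" for p
    proof -
      have "(\<Sum>s\<in>S. c' s * twist \<sigma> v s p) = (\<Sum>k=1..m. c' (h k) * twist \<sigma> v (h k) p)"
        by (rule sum.reindex_bij_betw[OF h, symmetric])
      also have "\<dots> = (\<Sum>k=1..m. c k * g k p)"
        by (intro sum.cong) (auto simp: g_def c'_def h')
      finally have e: "(\<Sum>s\<in>S. (\<alpha> * c' s + \<beta> * c' (\<sigma> s)) * v s p) = (\<Sum>k=1..m. c k * g k p)"
        using sum_twist[of S \<sigma> c' v p] \<sigma> by simp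
      have "c 0 * g 0 p + (\<Sum>k=1..m. c k * g k p) = 0"
        using z[of p] unfolding split by simp
      then show ?thesis
        unfolding e by (simp add: g_def mult.assoc)
    qed
    from indep[OF this] have c: "c 0 * (r / 3) = 0" "\<And>s. s \<in> S \<Longrightarrow> \<alpha> * c' s + \<beta> * c' (\<sigma> s) = 0"
      by auto
    have "c' (h k) = 0" if "k \<noteq> 0"
      using twist_coeff_zero[of S \<sigma> c'] c(2) \<sigma> hS[of k] k that by auto
    then show "c k = 0"
      using c(1) \<open>r \<noteq> 0\<close> k h'[of k] by (cases "k = 0") (auto simp: c'_def)
  next
    fix f :: "complex vec \<Rightarrow> complex mat"
    assume "\<And>k. k < m + 1 \<Longrightarrow> mat_coord (f (unit_vec (m + 1) k)) = g k"
    then have "induced3 (m + 1) f (small_CW m) = scale3 3 (\<Sum>i=1..m. sym3 (g 0) (g i) (g i))"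
      by (intro induced3_small_CW) auto
    also have "\<dots> = scale3 3 (\<Sum>i=1..m. scale3 (r / 3) (sym3 x (twist \<sigma> v (h i)) (twist \<sigma> v (h i))))"
      by (intro arg_cong[of _ _ "scale3 3"] sum.cong) (auto simp: g_def scale3_sym3)
    also have "\<dots> = scale3 r (\<Sum>i=1..m. sym3 x (twist \<sigma> v (h i)) (twist \<sigma> v (h i)))"
      by (simp add: scale3_sum scale3_scale3)
    also have "(\<Sum>i=1..m. sym3 x (twist \<sigma> v (h i)) (twist \<sigma> v (h i)))
        = (\<Sum>s\<in>S. sym3 x (twist \<sigma> v s) (twist \<sigma> v s))"
      by (rule sum.reindex_bij_betw[OF h])
    also have "(\<Sum>s\<in>S. sym3 x (twist \<sigma> v s) (twist \<sigma> v s)) = (\<Sum>s\<in>S. sym3 x (v s) (v (\<sigma> s)))"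
      by (rule sum_sym3_twist) (use \<sigma> in auto)
    finally show "induced3 (m + 1) f (small_CW m) = scale3 r (\<Sum>s\<in>S. sym3 x (v s) (v (\<sigma> s)))" .
  qed
qed

text \<open>As in the small case, with \<open>z\<close> up to scaling as the image of the last
  variable; the two scalars \<open>r\<close> and \<open>t\<close> are matched by rescaling
  \<open>x\<close> and \<open>z\<close> separately.\<close>

lemma eq_big_CW_involution:
  fixes v :: "'s \<Rightarrow> nat \<times> nat \<Rightarrow> complex"
  assumes S: "finite S" "card S = m"
    and \<sigma>: "\<And>s. s \<in> S \<Longrightarrow> \<sigma> s \<in> S" "\<And>s. s \<in> S \<Longrightarrow> \<sigma> (\<sigma> s) = s"
    and supp: "supported n x" "supported n z" "\<And>s. s \<in> S \<Longrightarrow> supported n (v s)"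
    and "r \<noteq> 0" "t \<noteq> 0"
    and indep: "\<And>c0 c1 c. (\<And>p. c0 * x p + c1 * z p + (\<Sum>s\<in>S. c s * v s p) = 0)
      \<Longrightarrow> c0 = 0 \<and> c1 = 0 \<and> (\<forall>s\<in>S. c s = 0)"
  shows "eq_big_CW n (scale3 t (sym3 x x z) + scale3 r (\<Sum>s\<in>S. sym3 x (v s) (v (\<sigma> s)))) m"
proof -
  obtain h where h: "bij_betw h {1..m} S"
    using S by (metis finite_same_card_bij finite_atLeastAtMost card_atLeastAtMost diff_Suc_1)
  define h' where "h' = inv_into {1..m} h"
  have h': "h' (h i) = i" if "i \<in> {1..m}" for i
    using that h by (simp add: h'_def bij_betw_inv_into_left)
  \<comment> \<open>The multiple of \<open>x\<close> is fixed by the sum of squares. The multiple of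
    \<open>z\<close> is then forced by 3 * (r/3)^2 * (3t/r^2) = t.\<close>
  define g where "g k = (if k = 0 then \<lambda>p. r / 3 * x p
    else if k = m + 1 then \<lambda>p. 3 * t / r\<^sup>2 * z p else twist \<sigma> v (h k))" for k :: nat
  have hS: "h i \<in> S" if "i \<in> {1..m}" for i
    using h that by (auto simp: bij_betw_def)
  have split: "{..<m + 2} = insert 0 (insert (m + 1) {1..m})"
    by auto
  show ?thesis
    unfolding eq_big_CW_def
  proof (rule eq_change_varsI[where g = g])
    show "supported n (g k)" if "k < m + 2" for k
      using that supp \<sigma> hS[of k] by (auto simp: g_def twist_def intro!: supported_intros)
  next
    fix c k
    assume zero: "\<And>p. (\<Sum>k<m + 2. c k * g k p) = 0" and k: "k < m + 2"
    define c' where "c' s = c (h' s)" for s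
    have "c 0 * (r / 3) * x p + c (m + 1) * (3 * t / r\<^sup>2) * z p
        + (\<Sum>s\<in>S. (\<alpha> * c' s + \<beta> * c' (\<sigma> s)) * v s p) = 0" for p
    proof -
      have "(\<Sum>s\<in>S. c' s * twist \<sigma> v s p) = (\<Sum>k=1..m. c' (h k) * twist \<sigma> v (h k) p)"
        by (rule sum.reindex_bij_betw[OF h, symmetric])
      also have "\<dots> = (\<Sum>k=1..m. c k * g k p)"
        by (intro sum.cong) (auto simp: g_def c'_def h')
      finally have e: "(\<Sum>s\<in>S. (\<alpha> * c' s + \<beta> * c' (\<sigma> s)) * v s p) = (\<Sum>k=1..m. c k * g k p)"
        using sum_twist[of S \<sigma> c' v p] \<sigma> by simp
      have "c 0 * g 0 p + c (m + 1) * g (m + 1) p + (\<Sum>k=1..m. c k * g k p) = 0"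
        using zero[of p] unfolding split by (simp add: add.assoc)
      then show ?thesis
        unfolding e by (simp add: g_def mult.assoc)
    qed
    from indep[OF this] have c: "c 0 * (r / 3) = 0" "c (m + 1) * (3 * t / r\<^sup>2) = 0"
      "\<And>s. s \<in> S \<Longrightarrow> \<alpha> * c' s + \<beta> * c' (\<sigma> s) = 0"
      by auto
    have "c' (h k) = 0" if "k \<noteq> 0" "k \<noteq> m + 1"
      using twist_coeff_zero[of S \<sigma> c'] c(3) \<sigma> hS[of k] k that by auto
    then show "c k = 0"
      using c(1,2) \<open>r \<noteq> 0\<close> \<open>t \<noteq> 0\<close> k h'[of k]
      by (cases "k = 0"; cases "k = m + 1") (auto simp: c'_def)
  next
    fix f :: "complex vec \<Rightarrow> complex mat"
    assume "\<And>k. k < m + 2 \<Longrightarrow> mat_coord (f (unit_vec (m + 2) k)) = g k"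
    then have "induced3 (m + 2) f (big_CW m) = scale3 3 (sym3 (g 0) (g 0) (g (m + 1)))
        + scale3 3 (\<Sum>i=1..m. sym3 (g 0) (g i) (g i))"
      by (intro induced3_big_CW) auto
    also have "scale3 3 (\<Sum>i=1..m. sym3 (g 0) (g i) (g i))
        = scale3 3 (\<Sum>i=1..m. scale3 (r / 3) (sym3 x (twist \<sigma> v (h i)) (twist \<sigma> v (h i))))"
      by (intro arg_cong[of _ _ "scale3 3"] sum.cong) (auto simp: g_def scale3_sym3)
    also have "\<dots> = scale3 r (\<Sum>i=1..m. sym3 x (twist \<sigma> v (h i)) (twist \<sigma> v (h i)))"
      by (simp add: scale3_sum scale3_scale3)
    also have "(\<Sum>i=1..m. sym3 x (twist \<sigma> v (h i)) (twist \<sigma> v (h i)))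
        = (\<Sum>s\<in>S. sym3 x (twist \<sigma> v s) (twist \<sigma> v s))"
      by (rule sum.reindex_bij_betw[OF h])
    also have "scale3 3 (sym3 (g 0) (g 0) (g (m + 1))) = scale3 t (sym3 x x z)"
      using \<open>r \<noteq> 0\<close> by (simp add: g_def scale3_def sym3_apply fun_eq_iff field_simps power2_eq_square)
    also have "(\<Sum>s\<in>S. sym3 x (twist \<sigma> v s) (twist \<sigma> v s)) = (\<Sum>s\<in>S. sym3 x (v s) (v (\<sigma> s)))"
      by (rule sum_sym3_twist) (use \<sigma> in auto)
    finally show "induced3 (m + 2) f (big_CW m)
        = scale3 t (sym3 x x z) + scale3 r (\<Sum>s\<in>S. sym3 x (v s) (v (\<sigma> s)))" .
  qed
qed

section \<open>Involutions without fixed points: sums over pairs\<close>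

lemma sym3_commute: "sym3 x z y = sym3 x y z"
  by (simp add: sym3_apply fun_eq_iff)

lemma sum_bool_pairs:
  fixes f :: "bool \<times> 'j \<Rightarrow> 'b :: comm_monoid_add"
  shows "(\<Sum>s\<in>UNIV \<times> J. f s) = (\<Sum>j\<in>J. f (True, j) + f (False, j))"
proof -
  have "(\<Sum>s\<in>UNIV \<times> J. f s) = (\<Sum>b\<in>UNIV. \<Sum>j\<in>J. f (b, j))"
    by (simp add: sum.cartesian_product)
  also have "\<dots> = (\<Sum>j\<in>J. \<Sum>b\<in>UNIV. f (b, j))"
    by (rule sum.swap)
  finally show ?thesis
    by (simp add: UNIV_bool add.commute)
qed

text \<open>The boolean tells \<open>u j\<close> from \<open>w j\<close>, and the involution flips
  it. Each product is therefore met twice, once from either factor.\<close>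

lemma sum_sym3_pairs:
  "(\<Sum>s\<in>UNIV \<times> J. sym3 x ((\<lambda>(b, j). if b then u j else w j) s)
      ((\<lambda>(b, j). if b then u j else w j) ((\<lambda>(b, j). (\<not> b, j)) s)))
    = scale3 2 (\<Sum>j\<in>J. sym3 x (u j) (w j))"
  unfolding sum_bool_pairs scale3_sum
  by (intro sum.cong refl) (simp add: sym3_commute[of x "w _"] scale3_def fun_eq_iff)

lemma scale3_half: "scale3 (1/2) (scale3 2 T) = T"
  by (simp add: scale3_def)

lemma eq_small_CW_pairs:
  fixes u w :: "'j \<Rightarrow> nat \<times> nat \<Rightarrow> complex"
  assumes J: "finite J" "2 * card J = m"
    and supp: "supported n x" "\<And>j. j \<in> J \<Longrightarrow> supported n (u j)" "\<And>j. j \<in> J \<Longrightarrow> supported n (w j)"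
    and indep: "\<And>c0 c d. (\<And>p. c0 * x p + (\<Sum>j\<in>J. c j * u j p + d j * w j p) = 0)
      \<Longrightarrow> c0 = 0 \<and> (\<forall>j\<in>J. c j = 0 \<and> d j = 0)"
  shows "eq_small_CW n (\<Sum>j\<in>J. sym3 x (u j) (w j)) m"
proof -
  let ?v = "\<lambda>(b, j). if b then u j else w j" and ?\<sigma> = "\<lambda>(b, j). (\<not> b, j)"
  \<comment> \<open>The scalar 1/2 undoes the double counting of the pairs.\<close>
  have "eq_small_CW n (scale3 (1/2) (\<Sum>s\<in>UNIV \<times> J. sym3 x (?v s) (?v (?\<sigma> s)))) m"
  proof (rule eq_small_CW_involution)
    fix c0 and c :: "bool \<times> 'j \<Rightarrow> complex"
    assume "\<And>p. c0 * x p + (\<Sum>s\<in>UNIV \<times> J. c s * ?v s p) = 0"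
    then have "c0 = 0 \<and> (\<forall>j\<in>J. c (True, j) = 0 \<and> c (False, j) = 0)"
      by (intro indep) (simp add: sum_bool_pairs)
    then show "c0 = 0 \<and> (\<forall>s\<in>UNIV \<times> J. c s = 0)"
      by (metis (full_types) SigmaE)
  qed (use J supp in \<open>auto simp: card_cartesian_product\<close>)
  then show ?thesis
    by (simp only: sum_sym3_pairs scale3_half)
qed

lemma eq_big_CW_pairs:
  fixes u w :: "'j \<Rightarrow> nat \<times> nat \<Rightarrow> complex"
  assumes J: "finite J" "2 * card J = m"
    and supp: "supported n x" "supported n z"
      "\<And>j. j \<in> J \<Longrightarrow> supported n (u j)" "\<And>j. j \<in> J \<Longrightarrow> supported n (w j)"
    and "t \<noteq> 0"
    and indep: "\<And>c0 c1 c d. (\<And>p. c0 * x p + c1 * z p + (\<Sum>j\<in>J. c j * u j p + d j * w j p) = 0)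
      \<Longrightarrow> c0 = 0 \<and> c1 = 0 \<and> (\<forall>j\<in>J. c j = 0 \<and> d j = 0)"
  shows "eq_big_CW n (scale3 t (sym3 x x z) + (\<Sum>j\<in>J. sym3 x (u j) (w j))) m"
proof -
  let ?v = "\<lambda>(b, j). if b then u j else w j" and ?\<sigma> = "\<lambda>(b, j). (\<not> b, j)"
  have "eq_big_CW n (scale3 t (sym3 x x z)
      + scale3 (1/2) (\<Sum>s\<in>UNIV \<times> J. sym3 x (?v s) (?v (?\<sigma> s)))) m"
  proof (rule eq_big_CW_involution)
    fix c0 c1 and c :: "bool \<times> 'j \<Rightarrow> complex"
    assume "\<And>p. c0 * x p + c1 * z p + (\<Sum>s\<in>UNIV \<times> J. c s * ?v s p) = 0"
    then have "c0 = 0 \<and> c1 = 0 \<and> (\<forall>j\<in>J. c (True, j) = 0 \<and> c (False, j) = 0)"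
      by (intro indep) (simp add: sum_bool_pairs)
    then show "c0 = 0 \<and> c1 = 0 \<and> (\<forall>s\<in>UNIV \<times> J. c s = 0)"
      by (metis (full_types) SigmaE)
  qed (use J supp \<open>t \<noteq> 0\<close> in \<open>auto simp: card_cartesian_product\<close>)
  then show ?thesis
    by (simp only: sum_sym3_pairs scale3_half)
qed

section \<open>Cubic forms in matrix units\<close>

text \<open>Positions count from 0, unlike in \<open>mat_unit\<close>, and the matrix size does not
  enter.\<close>

definition unit_coord :: "nat \<Rightarrow> nat \<Rightarrow> nat \<times> nat \<Rightarrow> complex" where
  "unit_coord i j p = (if p = (i, j) then 1 else 0)"

definition id_coord :: "nat \<Rightarrow> nat \<times> nat \<Rightarrow> complex" where
  "id_coord n p = (if fst p < n \<and> snd p = fst p then 1 else 0)"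

lemma mat_coord_mat_unit: "i < n \<Longrightarrow> j < n \<Longrightarrow> mat_coord (mat_unit n (Suc i) (Suc j)) = unit_coord i j"
  by (auto simp: mat_coord_def mat_unit_def unit_coord_def fun_eq_iff)

lemma mat_coord_one_mat: "mat_coord (1\<^sub>m n) = id_coord n"
  by (auto simp: mat_coord_def id_coord_def fun_eq_iff)

lemma supported_unit_coord: "i < n \<Longrightarrow> j < n \<Longrightarrow> supported n (unit_coord i j)"
  by (auto simp: supported_def unit_coord_def)

lemma supported_id_coord: "supported n (id_coord n)"
  by (auto simp: supported_def id_coord_def)

lemmas supported_basis = supported_intros supported_unit_coord supported_id_coord

section \<open>The five forms as Coppersmith-Winograd forms\<close>

lemma sym3_minus_right: "sym3 x y (- z) = - sym3 x y z"
  by (simp add: sym3_apply fun_eq_iff field_simps)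

text \<open>The two products of the minor are the two pairs, and the minus sign is absorbed into a
  factor of the second. For \<open>n \<ge> 3\<close> the entry at (0, 0) separates the identity from
  the four matrix units; for \<open>n = 2\<close> the identity lies in their span.\<close>

lemma eq_small_CW_id_minor:
  assumes "n \<ge> 3"
  shows "eq_small_CW n (sym3 (id_coord n) (unit_coord 0 (n - 1)) (unit_coord 1 (n - 2))
    - sym3 (id_coord n) (unit_coord 0 (n - 2)) (unit_coord 1 (n - 1))) 4"
proof -
  let ?u = "\<lambda>b. if b then unit_coord 0 (n - 1) else unit_coord 0 (n - 2)"
  let ?w = "\<lambda>b. if b then unit_coord 1 (n - 2) else - unit_coord 1 (n - 1)"
  have "eq_small_CW n (\<Sum>b\<in>UNIV. sym3 (id_coord n) (?u b) (?w b)) 4"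
  proof (rule eq_small_CW_pairs)
    fix c0 c d
    assume z: "\<And>p. c0 * id_coord n p + (\<Sum>b\<in>UNIV. c b * ?u b p + d b * ?w b p) = 0"
    have "c0 = 0"
      using z[of "(0, 0)"] assms by (simp add: UNIV_bool unit_coord_def id_coord_def)
    moreover have "c True = 0" "c False = 0" "d True = 0" "d False = 0"
      using z[of "(0, n - 1)"] z[of "(0, n - 2)"] z[of "(1, n - 2)"] z[of "(1, n - 1)"] assms \<open>c0 = 0\<close>
      by (auto simp: UNIV_bool unit_coord_def split: if_splits)
    ultimately show "c0 = 0 \<and> (\<forall>b\<in>UNIV. c b = 0 \<and> d b = 0)"
      by (auto simp: UNIV_bool)
  qed (use assms in \<open>auto intro!: supported_basis\<close>)
  then show ?thesis
    unfolding UNIV_bool by (simp add: sym3_minus_right fun_diff_def)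
qed

text \<open>One product of the minor contains \<open>x\<close> itself and supplies the
  \<open>x x z\<close> term with \<open>t = -1\<close>; the other is the only pair. The four
  positions involved are distinct already for \<open>n = 2\<close>.\<close>

lemma eq_big_CW_unit_minor:
  assumes "n \<ge> 2"
  shows "eq_big_CW n (sym3 (unit_coord 0 (n - 1)) (unit_coord 0 (n - 2)) (unit_coord 1 (n - 1))
    - sym3 (unit_coord 0 (n - 1)) (unit_coord 0 (n - 1)) (unit_coord 1 (n - 2))) 2"
proof -
  let ?x = "unit_coord 0 (n - 1)" and ?z = "unit_coord 1 (n - 2)"
  let ?u = "unit_coord 0 (n - 2)" and ?w = "unit_coord 1 (n - 1)"
  have "eq_big_CW n (scale3 (-1) (sym3 ?x ?x ?z) + (\<Sum>j\<in>{()}. sym3 ?x ?u ?w)) 2"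
  proof (rule eq_big_CW_pairs)
    fix c0 c1 and c d :: "unit \<Rightarrow> complex"
    assume z: "\<And>p. c0 * ?x p + c1 * ?z p + (\<Sum>j\<in>{()}. c j * ?u p + d j * ?w p) = 0"
    show "c0 = 0 \<and> c1 = 0 \<and> (\<forall>j\<in>{()}. c j = 0 \<and> d j = 0)"
      using z[of "(0, n - 1)"] z[of "(0, n - 2)"] z[of "(1, n - 2)"] z[of "(1, n - 1)"] assms
      by (auto simp: unit_coord_def split: if_splits)
  qed (use assms in \<open>auto intro!: supported_basis\<close>)
  moreover have "scale3 (-1) (sym3 ?x ?x ?z) + (\<Sum>j\<in>{()}. sym3 ?x ?u ?w)
    = sym3 ?x ?u ?w - sym3 ?x ?x ?z"
    by (simp add: fun_eq_iff scale3_def)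
  ultimately show ?thesis
    by (simp only:)
qed

lemma sum_split_ends:
  fixes f :: "nat \<Rightarrow> 'b :: comm_monoid_add"
  assumes "n \<ge> 2"
  shows "(\<Sum>i<n. f i) = f 0 + f (n - 1) + (\<Sum>i\<in>{1..<n - 1}. f i)"
proof -
  have "{..<n} = insert 0 (insert (n - 1) {1..<n - 1})"
    using assms by auto
  then show ?thesis
    using assms by (simp add: add.assoc del: One_nat_def)
qed

lemma sum_mult_unit_coord:
  assumes "finite J"
  shows "(\<Sum>j\<in>J. c j * unit_coord k j (a, b)) = (if a = k \<and> b \<in> J then c b else 0)"
    and "(\<Sum>j\<in>J. c j * unit_coord j k (a, b)) = (if b = k \<and> a \<in> J then c a else 0)"
proof -
  have "(\<Sum>j\<in>J. c j * unit_coord k j (a, b)) = (\<Sum>j\<in>J. if j = b then if a = k then c j else 0 else 0)"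
    by (intro sum.cong) (auto simp: unit_coord_def)
  then show "(\<Sum>j\<in>J. c j * unit_coord k j (a, b)) = (if a = k \<and> b \<in> J then c b else 0)"
    using assms by simp
  have "(\<Sum>j\<in>J. c j * unit_coord j k (a, b)) = (\<Sum>j\<in>J. if j = a then if b = k then c j else 0 else 0)"
    by (intro sum.cong) (auto simp: unit_coord_def)
  then show "(\<Sum>j\<in>J. c j * unit_coord j k (a, b)) = (if b = k \<and> a \<in> J then c a else 0)"
    using assms by simp
qed

text \<open>The terms for \<open>i = 0\<close> and \<open>i = n - 1\<close> share the top right
  matrix unit, so they merge into one product with the sum of two diagonal corners.\<close>

lemma sum_sym3_row_column:
  assumes "n \<ge> 2"
  shows "(\<Sum>i<n. sym3 x (unit_coord 0 i) (unit_coord i (n - 1)))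
    = sym3 x (unit_coord 0 (n - 1)) (unit_coord 0 0 + unit_coord (n - 1) (n - 1))
      + (\<Sum>i\<in>{1..<n - 1}. sym3 x (unit_coord 0 i) (unit_coord i (n - 1)))"
  unfolding sum_split_ends[OF assms]
  by (simp add: fun_eq_iff sym3_apply field_simps)

lemma eq_small_CW_id_row_column:
  assumes "n \<ge> 3"
  shows "eq_small_CW n (\<Sum>i<n. sym3 (id_coord n) (unit_coord 0 i) (unit_coord i (n - 1))) (2 * n - 2)"
proof -
  \<comment> \<open>The merged end terms are stored at index \<open>n - 1\<close>, which leaves
    \<open>n - 1\<close> pairs with independent factors.\<close>
  let ?w = "\<lambda>i. if i = n - 1 then unit_coord 0 0 + unit_coord (n - 1) (n - 1) else unit_coord i (n - 1)"
  have J: "{1..<n} = insert (n - 1) {1..<n - 1}"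
    using assms by auto
  have "eq_small_CW n (\<Sum>i\<in>{1..<n}. sym3 (id_coord n) (unit_coord 0 i) (?w i)) (2 * n - 2)"
  proof (rule eq_small_CW_pairs)
    fix c0 c d
    assume z: "\<And>p. c0 * id_coord n p + (\<Sum>i\<in>{1..<n}. c i * unit_coord 0 i p + d i * ?w i p) = 0"
    have s: "(\<Sum>i\<in>{1..<n}. c i * unit_coord 0 i (a, b) + d i * ?w i (a, b))
        = (if a = 0 \<and> b \<in> {1..<n} then c b else 0)
        + (if b = n - 1 \<and> a \<in> {1..<n - 1} then d a else 0)
        + d (n - 1) * (unit_coord 0 0 (a, b) + unit_coord (n - 1) (n - 1) (a, b))" for a b
    proof -
      have "(\<Sum>i\<in>{1..<n}. d i * ?w i (a, b)) = d (n - 1) * ?w (n - 1) (a, b)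
          + (\<Sum>i\<in>{1..<n - 1}. d i * ?w i (a, b))"
        unfolding J by simp
      also have "(\<Sum>i\<in>{1..<n - 1}. d i * ?w i (a, b)) = (\<Sum>i\<in>{1..<n - 1}. d i * unit_coord i (n - 1) (a, b))"
        by (intro sum.cong) auto
      finally show ?thesis
        unfolding sum.distrib by (simp only: sum_mult_unit_coord finite_atLeastLessThan) simp
    qed
    \<comment> \<open>For \<open>n \<ge> 3\<close> the position (1, 1) is an interior diagonal
      entry, where only the identity is nonzero. The remaining coefficients are read off
      afterwards.\<close>
    have c0: "c0 = 0"
      using z[of "(1, 1)"] assms unfolding s
      by (auto simp: id_coord_def unit_coord_def split: if_splits)
    have "c i = 0" if "i \<in> {1..<n}" for i
      using z[of "(0, i)"] that assms unfolding s c0 by (auto simp: unit_coord_def split: if_splits)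
    moreover have "d (n - 1) = 0"
      using z[of "(0, 0)"] assms unfolding s c0 by (auto simp: unit_coord_def split: if_splits)
    moreover have "d i = 0" if "i \<in> {1..<n - 1}" for i
      using z[of "(i, n - 1)"] that assms unfolding s c0 by (auto simp: unit_coord_def split: if_splits)
    ultimately show "c0 = 0 \<and> (\<forall>i\<in>{1..<n}. c i = 0 \<and> d i = 0)"
      using c0 unfolding J by blast
  qed (use assms in \<open>auto intro!: supported_basis\<close>)
  moreover have "(\<Sum>i\<in>{1..<n}. sym3 (id_coord n) (unit_coord 0 i) (?w i))
      = (\<Sum>i<n. sym3 (id_coord n) (unit_coord 0 i) (unit_coord i (n - 1)))"
  proof -
    have "(\<Sum>i\<in>{1..<n}. sym3 (id_coord n) (unit_coord 0 i) (?w i))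
      = sym3 (id_coord n) (unit_coord 0 (n - 1)) (?w (n - 1))
      + (\<Sum>i\<in>{1..<n - 1}. sym3 (id_coord n) (unit_coord 0 i) (?w i))"
      unfolding J by (rule sum.insert) auto
    also have "(\<Sum>i\<in>{1..<n - 1}. sym3 (id_coord n) (unit_coord 0 i) (?w i))
      = (\<Sum>i\<in>{1..<n - 1}. sym3 (id_coord n) (unit_coord 0 i) (unit_coord i (n - 1)))"
      by (intro sum.cong) auto
    finally show ?thesis
      using assms by (simp only: sum_sym3_row_column[of n] refl if_True)
  qed
  ultimately show ?thesis
    by (simp only:)
qed

text \<open>With \<open>x\<close> the top right unit, the merged end terms are exactly the
  \<open>x x z\<close> term, \<open>z\<close> being the sum of the two diagonal corners. The
  \<open>n - 2\<close> interior indices give the pairs; for \<open>n = 2\<close> there are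
  none.\<close>

lemma eq_big_CW_unit_row_column:
  assumes "n \<ge> 2"
  shows "eq_big_CW n (\<Sum>i<n. sym3 (unit_coord 0 (n - 1)) (unit_coord 0 i) (unit_coord i (n - 1)))
    (2 * n - 4)"
proof -
  let ?x = "unit_coord 0 (n - 1)" and ?z = "unit_coord 0 0 + unit_coord (n - 1) (n - 1)"
  have "eq_big_CW n (scale3 1 (sym3 ?x ?x ?z)
      + (\<Sum>i\<in>{1..<n - 1}. sym3 ?x (unit_coord 0 i) (unit_coord i (n - 1)))) (2 * n - 4)"
  proof (rule eq_big_CW_pairs)
    fix c0 c1 c d
    assume z: "\<And>p. c0 * ?x p + c1 * ?z p
      + (\<Sum>i\<in>{1..<n - 1}. c i * unit_coord 0 i p + d i * unit_coord i (n - 1) p) = 0"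
    have s: "(\<Sum>i\<in>{1..<n - 1}. c i * unit_coord 0 i (a, b) + d i * unit_coord i (n - 1) (a, b))
        = (if a = 0 \<and> b \<in> {1..<n - 1} then c b else 0)
        + (if b = n - 1 \<and> a \<in> {1..<n - 1} then d a else 0)" for a b
      unfolding sum.distrib by (simp only: sum_mult_unit_coord finite_atLeastLessThan)
    have "c0 = 0"
      using z[of "(0, n - 1)"] assms unfolding s by (auto simp: unit_coord_def split: if_splits)
    moreover have "c1 = 0"
      using z[of "(0, 0)"] assms unfolding s by (auto simp: unit_coord_def split: if_splits)
    moreover have "c i = 0" if "i \<in> {1..<n - 1}" for i
      using z[of "(0, i)"] that assms unfolding s by (auto simp: unit_coord_def split: if_splits)
    moreover have "d i = 0" if "i \<in> {1..<n - 1}" for i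
      using z[of "(i, n - 1)"] that assms unfolding s by (auto simp: unit_coord_def split: if_splits)
    ultimately show "c0 = 0 \<and> c1 = 0 \<and> (\<forall>i\<in>{1..<n - 1}. c i = 0 \<and> d i = 0)"
      by blast
  qed (use assms in \<open>auto intro!: supported_basis\<close>)
  moreover have "scale3 1 T = T" for T :: "(nat \<times> nat) tensor3"
    by (simp add: scale3_def)
  ultimately show ?thesis
    using assms by (simp only: sum_sym3_row_column)
qed

text \<open>The involution is transposition of positions, whose fixed points are the diagonal ones,
  so the version with pairs does not apply. The positions of \<open>x\<close> and of its transpose
  \<open>z\<close> are split off and form the \<open>x x z\<close> term.\<close>

lemma eq_big_CW_unit_trace_square:
  assumes "n \<ge> 2"
  shows "eq_big_CW n (\<Sum>i<n. \<Sum>j<n. sym3 (unit_coord 0 (n - 1)) (unit_coord i j) (unit_coord j i)) (n\<^sup>2 - 2)"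
proof -
  let ?x = "unit_coord 0 (n - 1)" and ?z = "unit_coord (n - 1) 0"
  let ?v = "\<lambda>(i, j). unit_coord i j"
  define S where "S = {..<n} \<times> {..<n} - {(0, n - 1), (n - 1, 0)}"
  have S: "{..<n} \<times> {..<n} = insert (0, n - 1) (insert (n - 1, 0) S)" "finite S"
    "(0, n - 1) \<notin> insert (n - 1, 0) S" "(n - 1, 0) \<notin> S"
    using assms by (auto simp: S_def)
  have "n * n = card ({..<n} \<times> {..<n})"
    by simp
  also have "\<dots> = card S + 2"
    unfolding S(1) using S by simp
  finally have card: "card S = n\<^sup>2 - 2"
    by (simp add: power2_eq_square)
  have "eq_big_CW n (scale3 2 (sym3 ?x ?x ?z)
      + scale3 1 (\<Sum>s\<in>S. sym3 ?x (?v s) (?v (prod.swap s)))) (n\<^sup>2 - 2)"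
  proof (rule eq_big_CW_involution)
    fix c0 c1 and c :: "nat \<times> nat \<Rightarrow> complex"
    assume z: "\<And>p. c0 * ?x p + c1 * ?z p + (\<Sum>s\<in>S. c s * ?v s p) = 0"
    have s: "(\<Sum>s\<in>S. c s * ?v s p) = (if p \<in> S then c p else 0)" for p
    proof -
      have "(\<Sum>s\<in>S. c s * ?v s p) = (\<Sum>s\<in>S. if s = p then c s else 0)"
        by (intro sum.cong) (auto simp: unit_coord_def)
      then show ?thesis
        using S by simp
    qed
    have "c0 = 0" "c1 = 0"
      using z[of "(0, n - 1)"] z[of "(n - 1, 0)"] assms S(3,4) unfolding s
      by (auto simp: unit_coord_def split: if_splits)
    moreover have "c s = 0" if "s \<in> S" for s
      using z[of s] that \<open>c0 = 0\<close> \<open>c1 = 0\<close> unfolding s by simp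
    ultimately show "c0 = 0 \<and> c1 = 0 \<and> (\<forall>s\<in>S. c s = 0)"
      by blast
  qed (use assms S(2) card in \<open>auto simp: S_def intro!: supported_basis\<close>)
  moreover have "scale3 2 (sym3 ?x ?x ?z) + scale3 1 (\<Sum>s\<in>S. sym3 ?x (?v s) (?v (prod.swap s)))
      = (\<Sum>i<n. \<Sum>j<n. sym3 ?x (unit_coord i j) (unit_coord j i))"
  proof -
    have "(\<Sum>i<n. \<Sum>j<n. sym3 ?x (unit_coord i j) (unit_coord j i))
        = (\<Sum>s\<in>{..<n} \<times> {..<n}. sym3 ?x (?v s) (?v (prod.swap s)))"
      by (simp add: sum.cartesian_product split_def)
    \<comment> \<open>Both removed positions give the same product of \<open>x\<close>,
      \<open>x\<close> and \<open>z\<close>, which is the origin of the coefficient 2.\<close>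
    also have "\<dots> = sym3 ?x ?x ?z + (sym3 ?x ?z ?x + (\<Sum>s\<in>S. sym3 ?x (?v s) (?v (prod.swap s))))"
      unfolding S(1) using S by (simp add: fun_eq_iff)
    finally show ?thesis
      unfolding sym3_commute[of ?x ?z ?x] by (simp add: fun_eq_iff scale3_def)
  qed
  ultimately show ?thesis
    by (simp only:)
qed

section \<open>Highest weight vectors\<close>

definition ad1 :: "nat \<Rightarrow> complex mat \<Rightarrow> (nat \<times> nat \<Rightarrow> complex) \<Rightarrow> nat \<times> nat \<Rightarrow> complex" where
  "ad1 n A x = (\<lambda>a. \<Sum>p\<in>{..<n} \<times> {..<n}. ad_coeff n A a p * x p)"

text \<open>The product of \<open>A\<close> with the matrix unit at (k, l) puts column
  \<open>k\<close> of \<open>A\<close> into column \<open>l\<close>; the product in the other order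
  puts row \<open>l\<close> of \<open>A\<close> into row \<open>k\<close>.\<close>

lemma ad_coeff_eq:
  assumes A: "A \<in> carrier_mat n n" and "k < n" "l < n"
  shows "ad_coeff n A (i, j) (k, l) = (if i < n \<and> j < n
    then (if j = l then A $$ (i, k) else 0) - (if i = k then A $$ (l, j) else 0) else 0)"
proof (cases "i < n \<and> j < n")
  case True
  let ?X = "mat_unit n (Suc k) (Suc l)"
  have X: "?X \<in> carrier_mat n n"
    by (simp add: mat_unit_def)
  have "(A * ?X) $$ (i, j) = (\<Sum>q<n. A $$ (i, q) * ?X $$ (q, j))"
    using A X True by (simp add: scalar_prod_def lessThan_atLeast0)
  also have "\<dots> = (\<Sum>q<n. if q = k then if j = l then A $$ (i, q) else 0 else 0)"
    using True by (intro sum.cong) (auto simp: mat_unit_def)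
  also have "\<dots> = (if j = l then A $$ (i, k) else 0)"
    using assms by simp
  finally have 1: "(A * ?X) $$ (i, j) = (if j = l then A $$ (i, k) else 0)" .
  have "(?X * A) $$ (i, j) = (\<Sum>q<n. ?X $$ (i, q) * A $$ (q, j))"
    using A X True by (simp add: scalar_prod_def lessThan_atLeast0)
  also have "\<dots> = (\<Sum>q<n. if q = l then if i = k then A $$ (q, j) else 0 else 0)"
    using True by (intro sum.cong) (auto simp: mat_unit_def)
  also have "\<dots> = (if i = k then A $$ (l, j) else 0)"
    using assms by simp
  finally have 2: "(?X * A) $$ (i, j) = (if i = k then A $$ (l, j) else 0)" .
  show ?thesis
    using A X True 1 2 by (simp add: ad_coeff_def Let_def mat_coord_def)
next
  case False
  then show ?thesis
    using A by (auto simp: ad_coeff_def Let_def mat_coord_def mat_unit_def)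
qed

lemma ad1_unit_coord:
  assumes A: "A \<in> carrier_mat n n" and kl: "k < n" "l < n"
  shows "ad1 n A (unit_coord k l) = (\<lambda>p. (\<Sum>i<n. A $$ (i, k) * unit_coord i l p)
    - (\<Sum>j<n. A $$ (l, j) * unit_coord k j p))"
proof
  fix a :: "nat \<times> nat"
  obtain i j where a: "a = (i, j)"
    by (cases a)
  have "ad1 n A (unit_coord k l) a = (\<Sum>p\<in>{..<n} \<times> {..<n}. if p = (k, l) then ad_coeff n A a p else 0)"
    unfolding ad1_def by (intro sum.cong) (auto simp: unit_coord_def)
  also have "\<dots> = ad_coeff n A (i, j) (k, l)"
    using kl a by simp
  finally show "ad1 n A (unit_coord k l) a = (\<Sum>i<n. A $$ (i, k) * unit_coord i l a)
      - (\<Sum>j<n. A $$ (l, j) * unit_coord k j a)"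
    using kl unfolding a by (simp add: ad_coeff_eq[OF A] sum_mult_unit_coord)
qed

text \<open>The identity is central: at position (i, j) each half of the bracket sums to the entry
  of \<open>A\<close> there.\<close>

lemma ad1_id_coord:
  assumes A: "A \<in> carrier_mat n n"
  shows "ad1 n A (id_coord n) = 0"
proof
  fix a :: "nat \<times> nat"
  obtain i j where a: "a = (i, j)"
    by (cases a)
  have "ad1 n A (id_coord n) a = (\<Sum>k<n. \<Sum>l<n. ad_coeff n A a (k, l) * id_coord n (k, l))"
    by (simp add: ad1_def sum.cartesian_product)
  also have "\<dots> = (\<Sum>k<n. \<Sum>l<n. if l = k then ad_coeff n A a (k, l) else 0)"
    by (intro sum.cong) (auto simp: id_coord_def)
  also have "\<dots> = (\<Sum>k<n. ad_coeff n A (i, j) (k, k))"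
    by (simp add: a)
  also have "\<dots> = (\<Sum>k<n. if i < n \<and> j < n then (if k = j then A $$ (i, k) else 0)
      - (if k = i then A $$ (k, j) else 0) else 0)"
    by (intro sum.cong) (auto simp: ad_coeff_eq[OF A])
  also have "\<dots> = 0"
    by (cases "i < n"; cases "j < n") (simp_all add: sum_subtractf)
  finally show "ad1 n A (id_coord n) a = 0 a"
    by simp
qed

text \<open>\<open>ad3\<close> acts slot by slot, whereas the symmetric product spreads each factor
  over all three slots. Regrouping the contributions by factor instead of by slot gives the
  derivation rule.\<close>

lemma ad3_sym3:
  "ad3 n A (sym3 x y z) = sym3 (ad1 n A x) y z + sym3 x (ad1 n A y) z + sym3 x y (ad1 n A z)"
proof (intro ext)
  fix a b c
  let ?S = "\<lambda>f. \<Sum>p\<in>{..<n} \<times> {..<n}. f p"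
  \<comment> \<open>Isolates the action on a single factor; \<open>r\<close> stands for the product
    of the two factors in the other slots.\<close>
  have pull: "?S (\<lambda>p. ad_coeff n A d p * (x p * r)) = ad1 n A x d * r" for d x r
    by (simp add: ad1_def sum_distrib_right mult.assoc)
  have 1: "?S (\<lambda>p. ad_coeff n A a p * sym3 x y z p b c)
    = (ad1 n A x a * (y b * z c + z b * y c) + ad1 n A y a * (x b * z c + z b * x c)
      + ad1 n A z a * (x b * y c + y b * x c)) / 6"
    unfolding pull[symmetric] sum.distrib[symmetric] sum_divide_distrib
    by (intro sum.cong refl) (simp add: sym3_apply field_simps)
  have 2: "?S (\<lambda>p. ad_coeff n A b p * sym3 x y z a p c)
    = (ad1 n A x b * (y a * z c + z a * y c) + ad1 n A y b * (x a * z c + z a * x c)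
      + ad1 n A z b * (x a * y c + y a * x c)) / 6"
    unfolding pull[symmetric] sum.distrib[symmetric] sum_divide_distrib
    by (intro sum.cong refl) (simp add: sym3_apply field_simps)
  have 3: "?S (\<lambda>p. ad_coeff n A c p * sym3 x y z a b p)
    = (ad1 n A x c * (y a * z b + z a * y b) + ad1 n A y c * (x a * z b + z a * x b)
      + ad1 n A z c * (x a * y b + y a * x b)) / 6"
    unfolding pull[symmetric] sum.distrib[symmetric] sum_divide_distrib
    by (intro sum.cong refl) (simp add: sym3_apply field_simps)
  show "ad3 n A (sym3 x y z) a b c
    = (sym3 (ad1 n A x) y z + sym3 x (ad1 n A y) z + sym3 x y (ad1 n A z)) a b c"
    unfolding ad3_def sum.distrib 1 2 3 by (simp add: sym3_apply field_simps)
qed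

lemma ad3_diff: "ad3 n A (S - T) = ad3 n A S - ad3 n A T"
  by (simp add: ad3_def fun_eq_iff sum_subtractf[symmetric] algebra_simps)

lemma ad3_add: "ad3 n A (S + T) = ad3 n A S + ad3 n A T"
  by (simp add: ad3_def fun_eq_iff sum.distrib[symmetric] algebra_simps)

lemma ad3_zero: "ad3 n A 0 = 0"
  by (simp add: ad3_def fun_eq_iff)

lemma ad3_sum: "ad3 n A (\<Sum>i\<in>I. T i) = (\<Sum>i\<in>I. ad3 n A (T i))"
  by (induction I rule: infinite_finite_induct)
    (simp_all only: sum.infinite sum.empty sum.insert ad3_add ad3_zero not_False_eq_True)

section \<open>Membership in the symmetric cube\<close>

lemma S3_gl_sym3: "supported n x \<Longrightarrow> supported n y \<Longrightarrow> supported n z \<Longrightarrow> sym3 x y z \<in> S3_gl n"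
proof -
  assume s: "supported n x" "supported n y" "supported n z"
  have "sym3 x y z a b c = 0" if "\<not> {a, b, c} \<subseteq> {..<n} \<times> {..<n}" for a b c
  proof -
    consider "a \<notin> {..<n} \<times> {..<n}" | "b \<notin> {..<n} \<times> {..<n}" | "c \<notin> {..<n} \<times> {..<n}"
      using \<open>\<not> _\<close> by blast
    then show ?thesis
      by cases (simp_all add: sym3_apply supportedD[OF s(1)] supportedD[OF s(2)] supportedD[OF s(3)])
  qed
  moreover have "sym3 x y z a b c = sym3 x y z b a c" "sym3 x y z a b c = sym3 x y z a c b" for a b c
    by (simp_all add: sym3_apply algebra_simps)
  ultimately show ?thesis
    unfolding S3_gl_def by blast
qed

lemma S3_gl_diff: "S \<in> S3_gl n \<Longrightarrow> T \<in> S3_gl n \<Longrightarrow> S - T \<in> S3_gl n"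
  unfolding S3_gl_def by clarsimp (metis diff_zero)

lemma S3_gl_add: "S \<in> S3_gl n \<Longrightarrow> T \<in> S3_gl n \<Longrightarrow> S + T \<in> S3_gl n"
  unfolding S3_gl_def by clarsimp (metis add_0)

lemma S3_gl_sum: "(\<And>i. i \<in> I \<Longrightarrow> T i \<in> S3_gl n) \<Longrightarrow> (\<Sum>i\<in>I. T i) \<in> S3_gl n"
proof (induction I rule: infinite_finite_induct)
  case (insert i I)
  then show ?case
    by (metis S3_gl_add insertCI sum.insert)
qed (simp_all add: S3_gl_def)

section \<open>Weights and raising operators on linear factors\<close>

lemma sym3_scale:
  "sym3 (\<lambda>p. r * x p) y z = scale3 r (sym3 x y z)"
  "sym3 x (\<lambda>p. r * y p) z = scale3 r (sym3 x y z)"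
  "sym3 x y (\<lambda>p. r * z p) = scale3 r (sym3 x y z)"
  by (simp_all add: sym3_apply scale3_def fun_eq_iff field_simps)

lemma sym3_zero: "sym3 0 y z = 0"
  by (simp add: sym3_apply fun_eq_iff)

text \<open>The nilpotent radical of the upper triangular Borel subalgebra; its elements have trace
  zero.\<close>

definition strictly_upper :: "nat \<Rightarrow> complex mat \<Rightarrow> bool" where
  "strictly_upper n A \<longleftrightarrow> A \<in> carrier_mat n n \<and> (\<forall>i<n. \<forall>j\<le>i. A $$ (i, j) = 0)"

lemma strictly_upperD:
  assumes "strictly_upper n A"
  shows "A \<in> carrier_mat n n" "i < n \<Longrightarrow> j \<le> i \<Longrightarrow> A $$ (i, j) = 0"
  using assms by (auto simp: strictly_upper_def)

definition weight_vec :: "nat \<Rightarrow> complex mat \<Rightarrow> complex \<Rightarrow> (nat \<times> nat \<Rightarrow> complex) \<Rightarrow> bool" where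
  "weight_vec n H r x \<longleftrightarrow> ad1 n H x = (\<lambda>p. r * x p)"

text \<open>A diagonal \<open>H\<close> leaves one term in each sum of
  \<open>ad1_unit_coord\<close>. The weight is the corresponding root, or 0 on the diagonal.\<close>

lemma weight_vec_unit_coord:
  assumes H: "H \<in> carrier_mat n n" "diagonal_mat H" and kl: "k < n" "l < n"
  shows "weight_vec n H (H $$ (k, k) - H $$ (l, l)) (unit_coord k l)"
  unfolding weight_vec_def
proof
  fix p :: "nat \<times> nat"
  have d: "H $$ (i, j) = 0" if "i < n" "j < n" "i \<noteq> j" for i j
    using H that by (auto simp: diagonal_mat_def)
  have "(\<Sum>i<n. H $$ (i, k) * unit_coord i l p) = (\<Sum>i<n. if i = k then H $$ (k, k) * unit_coord k l p else 0)"
    using kl d by (intro sum.cong) auto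
  moreover have "(\<Sum>j<n. H $$ (l, j) * unit_coord k j p) = (\<Sum>j<n. if j = l then H $$ (l, l) * unit_coord k l p else 0)"
    using kl d by (intro sum.cong) auto
  ultimately show "ad1 n H (unit_coord k l) p = (H $$ (k, k) - H $$ (l, l)) * unit_coord k l p"
    using kl by (simp add: ad1_unit_coord[OF H(1)] left_diff_distrib)
qed

text \<open>By the Leibniz rule weights add. The sum has its own name \<open>q\<close>, so that
  different products can be shown to have one common weight.\<close>

lemma ad3_weight_vec:
  assumes "weight_vec n H r x" "weight_vec n H s y" "weight_vec n H t z" "q = r + s + t"
  shows "ad3 n H (sym3 x y z) = scale3 q (sym3 x y z)"
  using assms unfolding weight_vec_def
  by (simp only: ad3_sym3 sym3_scale) (simp add: fun_eq_iff scale3_def algebra_simps)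

text \<open>The conditions on a highest weight vector of the adjoint representation on
  \<open>gl_n\<close>, in coordinates. Nonvanishing is checked later, on the whole cubic
  form.\<close>

definition highest_linear :: "nat \<Rightarrow> (nat \<times> nat \<Rightarrow> complex) \<Rightarrow> bool" where
  "highest_linear n x \<longleftrightarrow> supported n x \<and>
     (\<exists>wt. \<forall>H\<in>carrier_mat n n. diagonal_mat H \<longrightarrow> weight_vec n H (wt H) x) \<and>
     (\<forall>A. strictly_upper n A \<longrightarrow> ad1 n A x = 0)"

lemma highest_linear_id_coord: "highest_linear n (id_coord n)"
proof -
  have "\<forall>H\<in>carrier_mat n n. diagonal_mat H \<longrightarrow> weight_vec n H 0 (id_coord n)"
    by (simp add: weight_vec_def ad1_id_coord fun_eq_iff)
  then show ?thesis
    unfolding highest_linear_def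
    by (auto simp: supported_id_coord ad1_id_coord strictly_upper_def
      intro!: exI[of _ "\<lambda>_. 0"])
qed

text \<open>The first column of a strictly upper triangular matrix is zero, so only the row part of
  the bracket survives.\<close>

lemma ad1_upper_row_0:
  assumes A: "strictly_upper n A" and "l < n"
  shows "ad1 n A (unit_coord 0 l) = (\<lambda>p. - (\<Sum>j<n. A $$ (l, j) * unit_coord 0 j p))"
  using assms by (subst ad1_unit_coord) (auto simp: strictly_upperD[OF A] fun_eq_iff intro!: sum.neutral)

text \<open>Dually, the last row of such a matrix is zero, so only the column part survives.\<close>

lemma ad1_upper_last_column:
  assumes A: "strictly_upper n A" and "k < n"
  shows "ad1 n A (unit_coord k (n - 1)) = (\<lambda>p. \<Sum>i<n. A $$ (i, k) * unit_coord i (n - 1) p)"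
  using assms by (subst ad1_unit_coord) (auto simp: strictly_upperD[OF A] fun_eq_iff intro!: sum.neutral)

lemma highest_linear_unit_coord:
  assumes "n \<ge> 2"
  shows "highest_linear n (unit_coord 0 (n - 1))"
proof -
  have "ad1 n A (unit_coord 0 (n - 1)) = 0" if A: "strictly_upper n A" for A
    using assms by (subst ad1_upper_row_0[OF A]) (auto simp: strictly_upperD[OF A] fun_eq_iff intro!: sum.neutral)
  then show ?thesis
    unfolding highest_linear_def using assms
    by (intro conjI supported_unit_coord exI[of _ "\<lambda>H. H $$ (0, 0) - H $$ (n - 1, n - 1)"])
      (auto intro!: weight_vec_unit_coord)
qed

section \<open>A highest weight criterion and the three quadratic factors\<close>

lemma highest_weight_vectorI:
  assumes "T \<in> S3_gl n" "T a b c \<noteq> 0"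
    and "\<And>H. H \<in> carrier_mat n n \<Longrightarrow> diagonal_mat H \<Longrightarrow> ad3 n H T = scale3 (wt H) T"
    and "\<And>A. strictly_upper n A \<Longrightarrow> ad3 n A T = 0"
  shows "highest_weight_vector n T"
  unfolding highest_weight_vector_def
proof (intro conjI exI[of _ wt] ballI impI notI)
  assume "T = 0"
  then show False
    using assms(2) by simp
qed (use assms in \<open>auto simp: sl_def strictly_upper_def\<close>)

text \<open>Both products of the minor use rows 0, 1 and columns \<open>n - 2\<close>,
  \<open>n - 1\<close>, hence have the same weight. A raising operator adds a multiple of row 0 to
  row 1 and of column \<open>n - 1\<close> to column \<open>n - 2\<close>; each contribution is a
  minor with two equal rows or two equal columns.\<close>

lemma highest_minor:
  assumes n: "n \<ge> 2" and x: "highest_linear n x"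
    and nz: "(sym3 x (unit_coord 0 (n - 1)) (unit_coord 1 (n - 2))
      - sym3 x (unit_coord 0 (n - 2)) (unit_coord 1 (n - 1))) a b c \<noteq> 0"
  shows "highest_weight_vector n (sym3 x (unit_coord 0 (n - 1)) (unit_coord 1 (n - 2))
      - sym3 x (unit_coord 0 (n - 2)) (unit_coord 1 (n - 1)))" (is "highest_weight_vector n ?T")
proof -
  obtain wt where wt: "\<And>H. H \<in> carrier_mat n n \<Longrightarrow> diagonal_mat H \<Longrightarrow> weight_vec n H (wt H) x"
    using x by (auto simp: highest_linear_def)
  define q where "q H = wt H + (H $$ (0, 0) - H $$ (n - 1, n - 1)) + (H $$ (1, 1) - H $$ (n - 2, n - 2))" for H :: "complex mat"
  show ?thesis
  proof (rule highest_weight_vectorI[of _ _ a b c q])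
    show "?T \<in> S3_gl n"
      using x n by (intro S3_gl_diff S3_gl_sym3 supported_unit_coord) (auto simp: highest_linear_def)
  next
    fix H :: "complex mat"
    assume H: "H \<in> carrier_mat n n" "diagonal_mat H"
    have "ad3 n H (sym3 x (unit_coord 0 (n - 1)) (unit_coord 1 (n - 2)))
        = scale3 (q H) (sym3 x (unit_coord 0 (n - 1)) (unit_coord 1 (n - 2)))"
      by (rule ad3_weight_vec[OF wt[OF H] weight_vec_unit_coord[OF H] weight_vec_unit_coord[OF H]])
        (use n in \<open>auto simp: q_def\<close>)
    moreover have "ad3 n H (sym3 x (unit_coord 0 (n - 2)) (unit_coord 1 (n - 1)))
        = scale3 (q H) (sym3 x (unit_coord 0 (n - 2)) (unit_coord 1 (n - 1)))"
      by (rule ad3_weight_vec[OF wt[OF H] weight_vec_unit_coord[OF H] weight_vec_unit_coord[OF H]])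
        (use n in \<open>auto simp: q_def\<close>)
    ultimately show "ad3 n H ?T = scale3 (q H) ?T"
      unfolding ad3_diff by (simp add: scale3_def fun_eq_iff right_diff_distrib)
  next
    fix A :: "complex mat"
    assume A: "strictly_upper n A"
    have c: "A \<in> carrier_mat n n" and u: "\<And>i j. i < n \<Longrightarrow> j \<le> i \<Longrightarrow> A $$ (i, j) = 0"
      using strictly_upperD[OF A] by auto
    \<comment> \<open>By strict upper triangularity these are the only entries of column 1 and of
      row \<open>n - 2\<close> that can be nonzero.\<close>
    define s t where "s = A $$ (0, 1)" and "t = A $$ (n - 2, n - 1)"
    have last: "(\<Sum>j<n. A $$ (n - 2, j) * f j) = t * f (n - 1)" for f
    proof -
      have "(\<Sum>j<n. A $$ (n - 2, j) * f j) = (\<Sum>j<n. if j = n - 1 then t * f j else 0)"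
        using n u by (intro sum.cong) (auto simp: t_def)
      then show ?thesis
        using n by simp
    qed
    have first: "(\<Sum>i<n. A $$ (i, 1) * f i) = s * f 0" for f
    proof -
      have "(\<Sum>i<n. A $$ (i, 1) * f i) = (\<Sum>i<n. if i = 0 then s * f i else 0)"
        using n u by (intro sum.cong) (auto simp: s_def)
      then show ?thesis
        using n by simp
    qed
    have ads: "ad1 n A x = 0" "ad1 n A (unit_coord 0 (n - 1)) = 0"
      using x highest_linear_unit_coord[OF n] A by (auto simp: highest_linear_def)
    have ads1: "ad1 n A (unit_coord 0 (n - 2)) = (\<lambda>p. - (t * unit_coord 0 (n - 1) p))"
      using n by (subst ad1_upper_row_0[OF A]) (auto simp: last)
    have ads2: "ad1 n A (unit_coord 1 (n - 1)) = (\<lambda>p. s * unit_coord 0 (n - 1) p)"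
      using n by (subst ad1_upper_last_column[OF A]) (auto simp: first[simplified])
    have ads3: "ad1 n A (unit_coord 1 (n - 2))
        = (\<lambda>p. s * unit_coord 0 (n - 2) p - t * unit_coord 1 (n - 1) p)"
      using n by (subst ad1_unit_coord[OF c]) (auto simp: first[simplified] last)
    show "ad3 n A ?T = 0"
      unfolding ad3_diff ad3_sym3 ads ads1 ads2 ads3 by (simp add: fun_eq_iff sym3_apply field_simps)
  qed (rule nz)
qed

lemma sym3_sum_left: "sym3 x (\<lambda>p. \<Sum>i\<in>I. f i * g i p) y = (\<Sum>i\<in>I. scale3 (f i) (sym3 x (g i) y))"
  by (simp add: fun_eq_iff sym3_apply scale3_def sum_apply sum_distrib_left sum_distrib_right
      sum.distrib[symmetric] sum_divide_distrib algebra_simps)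

lemma sym3_sum_right: "sym3 x y (\<lambda>p. \<Sum>i\<in>I. f i * g i p) = (\<Sum>i\<in>I. scale3 (f i) (sym3 x y (g i)))"
  using sym3_sum_left[of x f g I y] by (simp only: sym3_commute[of x y])

lemma sym3_minus_left: "sym3 x (\<lambda>p. - y p) z = - sym3 x y z"
  by (simp add: sym3_apply fun_eq_iff field_simps)

lemma sym3_diff:
  "sym3 x (\<lambda>p. y p - y' p) z = sym3 x y z - sym3 x y' z"
  "sym3 x z (\<lambda>p. y p - y' p) = sym3 x z y - sym3 x z y'"
  by (simp_all add: sym3_apply fun_eq_iff field_simps)

text \<open>The inner index \<open>i\<close> contributes opposite weights to the two factors, so the
  weight does not depend on it. Under a raising operator the row factor and the column factor
  produce the same double sum with opposite signs, up to swapping the indices.\<close>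

lemma highest_row_column:
  assumes n: "n \<ge> 2" and x: "highest_linear n x"
    and nz: "(\<Sum>i<n. sym3 x (unit_coord 0 i) (unit_coord i (n - 1))) a b c \<noteq> 0"
  shows "highest_weight_vector n (\<Sum>i<n. sym3 x (unit_coord 0 i) (unit_coord i (n - 1)))"
    (is "highest_weight_vector n ?T")
proof -
  obtain wt where wt: "\<And>H. H \<in> carrier_mat n n \<Longrightarrow> diagonal_mat H \<Longrightarrow> weight_vec n H (wt H) x"
    using x by (auto simp: highest_linear_def)
  define q where "q H = wt H + H $$ (0, 0) - H $$ (n - 1, n - 1)" for H :: "complex mat"
  show ?thesis
  proof (rule highest_weight_vectorI[of _ _ a b c q])
    show "?T \<in> S3_gl n"
      using x n by (intro S3_gl_sum S3_gl_sym3 supported_unit_coord) (auto simp: highest_linear_def)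
  next
    fix H :: "complex mat"
    assume H: "H \<in> carrier_mat n n" "diagonal_mat H"
    have "ad3 n H (sym3 x (unit_coord 0 i) (unit_coord i (n - 1)))
        = scale3 (q H) (sym3 x (unit_coord 0 i) (unit_coord i (n - 1)))" if "i < n" for i
      by (rule ad3_weight_vec[OF wt[OF H] weight_vec_unit_coord[OF H] weight_vec_unit_coord[OF H]])
        (use n that in \<open>auto simp: q_def\<close>)
    then show "ad3 n H ?T = scale3 (q H) ?T"
      unfolding ad3_sum scale3_sum by (intro sum.cong) auto
  next
    fix A :: "complex mat"
    assume A: "strictly_upper n A"
    let ?m = "\<lambda>i j. scale3 (A $$ (i, j)) (sym3 x (unit_coord 0 j) (unit_coord i (n - 1)))"
    have x0: "ad1 n A x = 0"
      using x A by (auto simp: highest_linear_def)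
    have "ad3 n A (sym3 x (unit_coord 0 i) (unit_coord i (n - 1))) = (\<Sum>j<n. ?m j i) - (\<Sum>j<n. ?m i j)"
      if i: "i < n" for i
      unfolding ad3_sym3 x0 ad1_upper_row_0[OF A i] ad1_upper_last_column[OF A i]
        sym3_minus_left sym3_sum_left sym3_sum_right sym3_zero
      by (simp add: fun_eq_iff)
    then have "ad3 n A ?T = (\<Sum>i<n. (\<Sum>j<n. ?m j i) - (\<Sum>j<n. ?m i j))"
      unfolding ad3_sum by (intro sum.cong) auto
    also have "\<dots> = (\<Sum>i<n. \<Sum>j<n. ?m j i) - (\<Sum>i<n. \<Sum>j<n. ?m i j)"
      by (rule sum_subtractf)
    also have "(\<Sum>i<n. \<Sum>j<n. ?m j i) = (\<Sum>i<n. \<Sum>j<n. ?m i j)"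
      by (rule sum.swap)
    finally show "ad3 n A ?T = 0"
      by (simp only: diff_self)
  qed (rule nz)
qed

text \<open>The trace of the square is invariant under conjugation: the quadratic factor has weight
  0 and is killed by every raising operator, so \<open>x\<close> alone decides the weight.\<close>

lemma highest_trace_square:
  assumes n: "n \<ge> 2" and x: "highest_linear n x"
    and nz: "(\<Sum>i<n. \<Sum>j<n. sym3 x (unit_coord i j) (unit_coord j i)) a b c \<noteq> 0"
  shows "highest_weight_vector n (\<Sum>i<n. \<Sum>j<n. sym3 x (unit_coord i j) (unit_coord j i))"
    (is "highest_weight_vector n ?T")
proof -
  obtain wt where wt: "\<And>H. H \<in> carrier_mat n n \<Longrightarrow> diagonal_mat H \<Longrightarrow> weight_vec n H (wt H) x"
    using x by (auto simp: highest_linear_def)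
  show ?thesis
  proof (rule highest_weight_vectorI[of _ _ a b c wt])
    show "?T \<in> S3_gl n"
      using x n by (intro S3_gl_sum S3_gl_sym3 supported_unit_coord) (auto simp: highest_linear_def)
  next
    fix H :: "complex mat"
    assume H: "H \<in> carrier_mat n n" "diagonal_mat H"
    have "ad3 n H (sym3 x (unit_coord i j) (unit_coord j i))
        = scale3 (wt H) (sym3 x (unit_coord i j) (unit_coord j i))" if "i < n" "j < n" for i j
      by (rule ad3_weight_vec[OF wt[OF H] weight_vec_unit_coord[OF H] weight_vec_unit_coord[OF H]])
        (use that in auto)
    then show "ad3 n H ?T = scale3 (wt H) ?T"
      unfolding ad3_sum scale3_sum by (intro sum.cong) auto
  next
    fix A :: "complex mat"
    assume A: "strictly_upper n A"
    let ?m = "\<lambda>i j k. scale3 (A $$ (i, k)) (sym3 x (unit_coord i j) (unit_coord j k))"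
    have x0: "ad1 n A x = 0"
      using x A by (auto simp: highest_linear_def)
    have "ad3 n A (sym3 x (unit_coord i j) (unit_coord j i))
        = ((\<Sum>k<n. ?m k j i) - (\<Sum>k<n. ?m i j k)) + ((\<Sum>k<n. ?m k i j) - (\<Sum>k<n. ?m j i k))"
      if i: "i < n" and j: "j < n" for i j
    proof -
      \<comment> \<open>Reorders the factors so that the column of the first is the row of the
        second. All four sums then have the common form \<open>?m\<close>.\<close>
      have comm: "sym3 x (unit_coord i k) (unit_coord j i) = sym3 x (unit_coord j i) (unit_coord i k)"
        "sym3 x (unit_coord i j) (unit_coord k i) = sym3 x (unit_coord k i) (unit_coord i j)" for k
        by (rule sym3_commute)+
      show ?thesis
        unfolding ad3_sym3 x0 ad1_unit_coord[OF strictly_upperD(1)[OF A] i j]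
          ad1_unit_coord[OF strictly_upperD(1)[OF A] j i] sym3_diff sym3_sum_left sym3_sum_right
          sym3_zero
        unfolding comm by (simp add: fun_eq_iff)
    qed
    then have "ad3 n A ?T = (\<Sum>i<n. \<Sum>j<n. ((\<Sum>k<n. ?m k j i) - (\<Sum>k<n. ?m i j k))
        + ((\<Sum>k<n. ?m k i j) - (\<Sum>k<n. ?m j i k)))"
      unfolding ad3_sum by (intro sum.cong) auto
    also have "\<dots> = ((\<Sum>i<n. \<Sum>j<n. \<Sum>k<n. ?m k j i) - (\<Sum>i<n. \<Sum>j<n. \<Sum>k<n. ?m i j k))
        + ((\<Sum>i<n. \<Sum>j<n. \<Sum>k<n. ?m k i j) - (\<Sum>i<n. \<Sum>j<n. \<Sum>k<n. ?m j i k))"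
      by (simp only: sum.distrib sum_subtractf)
    finally have ad: "ad3 n A ?T = \<dots>" .
    have swap: "(\<Sum>i<n. \<Sum>j<n. f k i j) = (\<Sum>i<n. \<Sum>j<n. f k j i)"
      for k and f :: "nat \<Rightarrow> nat \<Rightarrow> nat \<Rightarrow> (nat \<times> nat) tensor3"
      by (rule sum.swap)
    have 1: "(\<Sum>i<n. \<Sum>j<n. \<Sum>k<n. ?m k i j) = (\<Sum>i<n. \<Sum>j<n. \<Sum>k<n. ?m j i k)"
      by (intro sum.cong refl swap[where f = "\<lambda>i j k. ?m k i j"])
    \<comment> \<open>Exchanging the outermost with the innermost index takes three swaps of
      adjacent sums.\<close>
    have "(\<Sum>i<n. \<Sum>j<n. \<Sum>k<n. ?m k j i) = (\<Sum>j<n. \<Sum>i<n. \<Sum>k<n. ?m k j i)"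
      by (rule sum.swap)
    also have "\<dots> = (\<Sum>j<n. \<Sum>k<n. \<Sum>i<n. ?m k j i)"
      by (intro sum.cong refl swap[where f = "\<lambda>j i k. ?m k j i"])
    also have "\<dots> = (\<Sum>k<n. \<Sum>j<n. \<Sum>i<n. ?m k j i)"
      by (rule sum.swap)
    finally have 2: "(\<Sum>i<n. \<Sum>j<n. \<Sum>k<n. ?m k j i) = (\<Sum>i<n. \<Sum>j<n. \<Sum>k<n. ?m i j k)" .
    show "ad3 n A ?T = 0"
      unfolding ad 1 2 by (simp only: diff_self add_0)
  qed (rule nz)
qed

section \<open>Passage to counting from 1, nonvanishing, and the theorem\<close>

lemma sum_one_upto: "(\<Sum>i=1..n. f i) = (\<Sum>i<n. f (Suc i))"
  by (simp add: sum.atLeast1_atMost_eq)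

lemma mat_prod3_units:
  assumes "n \<ge> 2"
  shows "(\<Sum>i=1..n. mat_prod3 X (mat_unit n 1 i) (mat_unit n i n))
      = (\<Sum>i<n. sym3 (mat_coord X) (unit_coord 0 i) (unit_coord i (n - 1)))"
    and "(\<Sum>i=1..n. \<Sum>j=1..n. mat_prod3 X (mat_unit n i j) (mat_unit n j i))
      = (\<Sum>i<n. \<Sum>j<n. sym3 (mat_coord X) (unit_coord i j) (unit_coord j i))"
proof -
  have "mat_coord (mat_unit n 1 (Suc i)) = unit_coord 0 i"
    "mat_coord (mat_unit n (Suc i) n) = unit_coord i (n - 1)" if "i < n" for i
    using assms that mat_coord_mat_unit[of 0 n i] mat_coord_mat_unit[of i n "n - 1"] by simp_all
  then show "(\<Sum>i=1..n. mat_prod3 X (mat_unit n 1 i) (mat_unit n i n))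
      = (\<Sum>i<n. sym3 (mat_coord X) (unit_coord 0 i) (unit_coord i (n - 1)))"
    unfolding sum_one_upto mat_prod3_def by (intro sum.cong) auto
  show "(\<Sum>i=1..n. \<Sum>j=1..n. mat_prod3 X (mat_unit n i j) (mat_unit n j i))
      = (\<Sum>i<n. \<Sum>j<n. sym3 (mat_coord X) (unit_coord i j) (unit_coord j i))"
    unfolding sum_one_upto mat_prod3_def by (intro sum.cong refl) (simp add: mat_coord_mat_unit)
qed

text \<open>Serves the second form, in which the minor appears with the opposite sign.\<close>

lemma highest_weight_vector_uminus:
  assumes "highest_weight_vector n T"
  shows "highest_weight_vector n (- T)"
proof -
  have "ad3 n A (- T) = - ad3 n A T" for A
    using ad3_diff[of n A 0 T] by (simp only: ad3_zero diff_0)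
  moreover have "scale3 r (- T) = - scale3 r T" for r
    by (simp add: scale3_def fun_eq_iff)
  moreover have "- T \<in> S3_gl n" if "T \<in> S3_gl n"
    using that unfolding S3_gl_def mem_Collect_eq uminus_apply neg_equal_iff_equal neg_equal_0_iff_equal .
  ultimately show ?thesis
    using assms unfolding highest_weight_vector_def
    by (simp only: neg_equal_0_iff_equal neg_equal_iff_equal) blast
qed

lemma highest_weight_vector_id_minor:
  assumes "n \<ge> 2"
  shows "highest_weight_vector n (sym3 (id_coord n) (unit_coord 0 (n - 1)) (unit_coord 1 (n - 2))
    - sym3 (id_coord n) (unit_coord 0 (n - 2)) (unit_coord 1 (n - 1)))"
  using assms
  \<comment> \<open>At this coordinate the second product vanishes: the position (0, n - 1) lies off
    the diagonal and differs from those of both its matrix units.\<close>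
  by (intro highest_minor[where a = "(0, 0)" and b = "(0, n - 1)" and c = "(1, n - 2)"] highest_linear_id_coord)
    (auto simp: sym3_apply unit_coord_def id_coord_def)

lemma highest_weight_vector_unit_minor:
  assumes "n \<ge> 2"
  shows "highest_weight_vector n (sym3 (unit_coord 0 (n - 1)) (unit_coord 0 (n - 2)) (unit_coord 1 (n - 1))
    - sym3 (unit_coord 0 (n - 1)) (unit_coord 0 (n - 1)) (unit_coord 1 (n - 2)))"
proof -
  have "highest_weight_vector n (sym3 (unit_coord 0 (n - 1)) (unit_coord 0 (n - 1)) (unit_coord 1 (n - 2))
      - sym3 (unit_coord 0 (n - 1)) (unit_coord 0 (n - 2)) (unit_coord 1 (n - 1)))"
    using assms
    by (intro highest_minor[where a = "(0, n - 1)" and b = "(0, n - 1)" and c = "(1, n - 2)"]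
        highest_linear_unit_coord) (auto simp: sym3_apply unit_coord_def)
  from highest_weight_vector_uminus[OF this] show ?thesis
    by (simp only: minus_diff_eq)
qed

lemma highest_weight_vector_id_row_column:
  assumes n: "n \<ge> 2"
  shows "highest_weight_vector n (\<Sum>i<n. sym3 (id_coord n) (unit_coord 0 i) (unit_coord i (n - 1)))"
proof (rule highest_row_column[OF n highest_linear_id_coord])
  \<comment> \<open>All three positions lie in row 0, while every interior term has a factor in row
    \<open>i\<close> with \<open>i \<ge> 1\<close>. Only the merged end terms remain.\<close>
  have "(\<Sum>i\<in>{1..<n - 1}. sym3 (id_coord n) (unit_coord 0 i) (unit_coord i (n - 1))
      (0, 0) (0, 0) (0, n - 1)) = 0"
    by (intro sum.neutral) (auto simp: sym3_apply unit_coord_def)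
  then show "(\<Sum>i<n. sym3 (id_coord n) (unit_coord 0 i) (unit_coord i (n - 1)))
      (0, 0) (0, 0) (0, n - 1) \<noteq> 0"
    using n unfolding sum_sym3_row_column[OF n] plus_fun_apply sum_apply
    by (simp add: sym3_apply unit_coord_def id_coord_def)
qed

lemma highest_weight_vector_unit_row_column:
  assumes n: "n \<ge> 2"
  shows "highest_weight_vector n (\<Sum>i<n. sym3 (unit_coord 0 (n - 1)) (unit_coord 0 i) (unit_coord i (n - 1)))"
proof (rule highest_row_column[OF n highest_linear_unit_coord[OF n]])
  have "(\<Sum>i\<in>{1..<n - 1}. sym3 (unit_coord 0 (n - 1)) (unit_coord 0 i) (unit_coord i (n - 1))
      (0, 0) (0, n - 1) (0, n - 1)) = 0"
    by (intro sum.neutral) (auto simp: sym3_apply unit_coord_def)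
  then show "(\<Sum>i<n. sym3 (unit_coord 0 (n - 1)) (unit_coord 0 i) (unit_coord i (n - 1)))
      (0, 0) (0, n - 1) (0, n - 1) \<noteq> 0"
    using n unfolding sum_sym3_row_column[OF n] plus_fun_apply sum_apply
    by (simp add: sym3_apply unit_coord_def)
qed

lemma highest_weight_vector_unit_trace_square:
  assumes n: "n \<ge> 2"
  shows "highest_weight_vector n (\<Sum>i<n. \<Sum>j<n. sym3 (unit_coord 0 (n - 1)) (unit_coord i j) (unit_coord j i))"
proof (rule highest_trace_square[OF n highest_linear_unit_coord[OF n]])
  \<comment> \<open>Only \<open>i = j = 0\<close> contributes: two of the six orderings match the
    positions, which gives 2/6.\<close>
  have "(\<Sum>i<n. \<Sum>j<n. sym3 (unit_coord 0 (n - 1)) (unit_coord i j) (unit_coord j i)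
      (0, n - 1) (0, 0) (0, 0)) = (\<Sum>i<n. \<Sum>j<n. if j = 0 then if i = 0 then 1 / 3 else 0 else 0)"
    using n by (intro sum.cong) (auto simp: sym3_apply unit_coord_def)
  also have "\<dots> = 1 / 3"
    using n by simp
  finally have e: "(\<Sum>i<n. \<Sum>j<n. sym3 (unit_coord 0 (n - 1)) (unit_coord i j) (unit_coord j i)
      (0, n - 1) (0, 0) (0, 0)) = 1 / 3" .
  show "(\<Sum>i<n. \<Sum>j<n. sym3 (unit_coord 0 (n - 1)) (unit_coord i j) (unit_coord j i))
      (0, n - 1) (0, 0) (0, 0) \<noteq> 0"
    unfolding sum_apply e by simp
qed

text \<open>The condition \<open>n \<ge> 3\<close> marks genuine exceptions. For
  \<open>n = 2\<close> the first form would need five independent variables in the four-dimensional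
  \<open>gl_2\<close>, and the third becomes the product of \<open>I\<close>, \<open>I\<close> and
  the top right unit, a form in only two variables.\<close>

theorem proposition3p1:
  fixes n :: nat
  assumes "n \<ge> 2"
  shows "let I = 1\<^sub>m n; E = mat_unit n;
      F1 = mat_prod3 I (E 1 n) (E 2 (n - 1)) - mat_prod3 I (E 1 (n - 1)) (E 2 n);
      F2 = mat_prod3 (E 1 n) (E 1 (n - 1)) (E 2 n) - mat_prod3 (E 1 n) (E 1 n) (E 2 (n - 1));
      F3 = (\<Sum>i=1..n. mat_prod3 I (E 1 i) (E i n));
      F4 = (\<Sum>i=1..n. mat_prod3 (E 1 n) (E 1 i) (E i n));
      F5 = (\<Sum>i=1..n. \<Sum>j=1..n. mat_prod3 (E 1 n) (E i j) (E j i))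
    in
      (highest_weight_vector n F1 \<and> (n \<ge> 3 \<longrightarrow> eq_small_CW n F1 4)) \<and>
      (highest_weight_vector n F2 \<and> eq_big_CW n F2 2) \<and>
      (highest_weight_vector n F3 \<and> (n \<ge> 3 \<longrightarrow> eq_small_CW n F3 (2 * n - 2))) \<and>
      (highest_weight_vector n F4 \<and> eq_big_CW n F4 (2 * n - 4)) \<and>
      (highest_weight_vector n F5 \<and> eq_big_CW n F5 (n\<^sup>2 - 2))"
proof -
  obtain k where k: "n = Suc (Suc k)"
    using assms by (metis Suc_le_D numeral_2_eq_2 Suc_le_mono)
  have E: "mat_coord (mat_unit n 1 n) = unit_coord 0 (n - 1)"
    "mat_coord (mat_unit n 2 (n - 1)) = unit_coord 1 (n - 2)"
    "mat_coord (mat_unit n 1 (n - 1)) = unit_coord 0 (n - 2)"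
    "mat_coord (mat_unit n 2 n) = unit_coord 1 (n - 1)"
    by (simp_all add: k numeral_2_eq_2 mat_coord_mat_unit)
  show ?thesis
    \<comment> \<open>The sums are rewritten while \<open>mat_prod3\<close> is still folded, since
      \<open>mat_prod3_units\<close> matches on it.\<close>
    unfolding Let_def mat_prod3_units[OF assms] unfolding mat_prod3_def E mat_coord_one_mat
    using assms
    by (intro conjI impI eq_small_CW_id_minor eq_big_CW_unit_minor eq_small_CW_id_row_column
        eq_big_CW_unit_row_column eq_big_CW_unit_trace_square
        highest_weight_vector_id_minor highest_weight_vector_unit_minor highest_weight_vector_id_row_column
        highest_weight_vector_unit_row_column highest_weight_vector_unit_trace_square)
qed

end
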